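(* Let $G=(V,E)$ be a locally finite, connected, transitive and transient (simple, undirected) graph, and let $\Gamma=\mathrm{Aut}(G)$. Then the following conditions are equivalent: (A) $G$ is unimodular. (B) There is no measure $Q$ on $(W,\mathcal{W})$ satisfying both (i) $\nu(A)=Q((\pi^* )^{-1}(A))$ for all $A\in\mathcal{W}^*$, and (ii) $Q(B)=Q(\varphi(B))$ for all $B\in\mathcal{W}$ and all $\varphi\in\Gamma$, where $\nu$ is the interlacement intensity measure on $(W^*,\mathcal{W}^* )$.
   Context: $G$ is transitive if $\Gamma=\mathrm{Aut}(G)$ acts transitively on $V$; transient if simple random walk on $G$ is transient. $K\subset\subset V$ means $K$ is a finite subset of $V$. Unimodularity: a function $f:V\times V\to[0,\infty)$ is a mass transport function if $f(x,y)=f(\varphi(x),\varphi(y))$ for all $x,y\in V$, $\varphi\in\Gamma$. The transitive graph $G$ is unimodular if for every vertex $o\in V$ and every mass transport function $f$, $\sum_{x\in V}f(o,x)=\sum_{x\in V}f(x,o)$. Trajectories: $W$ is the set of $w:\mathbb{Z}\to V$ with $\{w(n),w(n+1)\}\in E$ for all $n$ and such that each vertex is visited only finitely many times; $\mathcal{W}$ is the $\sigma$-algebra on $W$ generated by the coordinate maps. $w,w'\in W$ are time-shift equivalent if for some $k\in\mathbb{Z}$, $w(n)=w'(n+k)$ for all $n$. $W^*$ is the set of equivalence classes, $\pi^*:W\to W^*$ the quotient map, $\mathcal{W}^*=\{A\subseteq W^*:(\pi^* )^{-1}(A)\in\mathcal{W}\}$. $W^*(K)$ is the set of classes of trajectories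 that visit $K$. $\varphi\in\Gamma$ acts on $W$ by $\varphi(w)=(\varphi(w(n)))_n$, and on $B\in\mathcal{W}$ by taking images. Interlacement intensity measure: $P_x^{\pm}$ is the law on $(W,\mathcal{W})$ of a doubly infinite simple random walk $(X(n))_{n\in\mathbb{Z}}$ with $X(0)=x$ (forward path and time-reversed backward path are independent simple random walks from $x$). For $w$ visiting $K$, $H_K(w)=\min\{n:w(n)\in K\}$. $\nu$ is the unique $\sigma$-finite measure on $(W^*,\mathcal{W}^* )$ such that for all $A\in\mathcal{W}^*$ and all $K\subset\subset V$, $\nu(A\cap W^*(K))=Q_K((\pi^* )^{-1}(A))$, where $Q_K(B)=\sum_{x\in K}P_x^{\pm}(B,\,H_K=0)$ for $B\in\mathcal{W}$ (existence and uniqueness of $\nu$ are known). *)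

theory Defs
  imports "HOL-Probability.Probability"
begin

text \<open>
  The vertex set is the whole (arbitrary) type \<open>'v\<close>; a graph is given by its set
  of edges, an edge being an unordered pair of distinct vertices.
\<close>

definition simple_graph :: "'v set set \<Rightarrow> bool" where
  "simple_graph E \<longleftrightarrow> (\<forall>e\<in>E. card e = 2)"

definition nbrs :: "'v set set \<Rightarrow> 'v \<Rightarrow> 'v set" where
  "nbrs E x = {y. {x, y} \<in> E}"

definition locally_finite_graph :: "'v set set \<Rightarrow> bool" where
  "locally_finite_graph E \<longleftrightarrow> (\<forall>x. finite (nbrs E x))"

definition connected_graph :: "'v set set \<Rightarrow> bool" where
  "connected_graph E \<longleftrightarrow> (\<forall>x y. (x, y) \<in> {(u, v). {u, v} \<in> E}\<^sup>*)"

definition graph_aut :: "'v set set \<Rightarrow> ('v \<Rightarrow> 'v) set" where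
  "graph_aut E = {\<phi>. bij \<phi> \<and> (\<forall>x y. {x, y} \<in> E \<longleftrightarrow> {\<phi> x, \<phi> y} \<in> E)}"

definition transitive_graph :: "'v set set \<Rightarrow> bool" where
  "transitive_graph E \<longleftrightarrow> (\<forall>x y. \<exists>\<phi>\<in>graph_aut E. \<phi> x = y)"

definition mass_transport :: "'v set set \<Rightarrow> ('v \<Rightarrow> 'v \<Rightarrow> real) \<Rightarrow> bool" where
  "mass_transport E f \<longleftrightarrow>
     (\<forall>x y. 0 \<le> f x y) \<and> (\<forall>x y. \<forall>\<phi>\<in>graph_aut E. f x y = f (\<phi> x) (\<phi> y))"

text \<open>The sums of nonnegative terms below may be infinite, hence are taken in \<open>ennreal\<close>.\<close>

definition unimodular_graph :: "'v set set \<Rightarrow> bool" where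
  "unimodular_graph E \<longleftrightarrow> (\<forall>v f. mass_transport E f \<longrightarrow>
     (\<integral>\<^sup>+x. ennreal (f v x) \<partial>count_space UNIV) = (\<integral>\<^sup>+x. ennreal (f x v) \<partial>count_space UNIV))"

text \<open>
  \<open>srw_kernel E x n \<omega>\<close> is the conditional law of the position at time \<open>n\<close> given the
  positions \<open>\<omega> 0, \<dots>, \<omega> (n - 1)\<close>. In a connected graph with at least two vertices
  \<open>nbrs E y\<close> is never empty, so that \<open>pmf_of_set (nbrs E y)\<close> is the uniform
  distribution on the neighbours of \<open>y\<close>.
\<close>

definition srw_kernel :: "'v set set \<Rightarrow> 'v \<Rightarrow> nat \<Rightarrow> (nat \<Rightarrow> 'v) \<Rightarrow> 'v measure" where
  "srw_kernel E x n \<omega> =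
     measure_pmf (case n of 0 \<Rightarrow> return_pmf x | Suc m \<Rightarrow> pmf_of_set (nbrs E (\<omega> m)))"

lemma Ionescu_Tulcea_srw_kernel: "Ionescu_Tulcea (srw_kernel E x) (\<lambda>_. count_space UNIV)"
proof (rule Ionescu_Tulcea.intro)
  show "prob_space (srw_kernel E x i \<omega>)" for i \<omega>
    unfolding srw_kernel_def by (rule measure_pmf.prob_space_axioms)
  show "srw_kernel E x i \<in>
      measurable (PiM {0..<i} (\<lambda>_. count_space UNIV)) (subprob_algebra (count_space UNIV))" for i
  proof (cases i)
    case 0
    then have "srw_kernel E x i = (\<lambda>_. measure_pmf (return_pmf x))"
      by (simp add: srw_kernel_def fun_eq_iff)
    then show ?thesis
      by (simp add: space_subprob_algebra measure_pmf.subprob_space_axioms)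
  next
    case (Suc m)
    have "(\<lambda>\<omega>. \<omega> m) \<in> measurable (PiM {0..<i} (\<lambda>_. count_space UNIV)) (count_space (UNIV :: 'a set))"
      using Suc by (intro measurable_component_singleton) auto
    moreover have "(\<lambda>y. measure_pmf (pmf_of_set (nbrs E y)))
        \<in> measurable (count_space UNIV) (subprob_algebra (count_space UNIV))"
      by (auto simp: space_subprob_algebra measure_pmf.subprob_space_axioms)
    ultimately have "(\<lambda>\<omega>. measure_pmf (pmf_of_set (nbrs E (\<omega> m)))) \<in>
        measurable (PiM {0..<i} (\<lambda>_. count_space UNIV)) (subprob_algebra (count_space UNIV))"
      by (rule measurable_compose)
    then show ?thesis
      using Suc by (simp add: srw_kernel_def[abs_def])
  qed
qed

text \<open>
  The law of simple random walk started at \<open>x\<close>, given by the Ionescu-Tulcea theorem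
  (the global name of \<open>PF.lim\<close> in locale \<^locale>\<open>Ionescu_Tulcea\<close>).
\<close>

definition srw :: "'v set set \<Rightarrow> 'v \<Rightarrow> (nat \<Rightarrow> 'v) measure" where
  "srw E x = projective_family.lim UNIV
     (Ionescu_Tulcea.CI (srw_kernel E x) (\<lambda>_. count_space UNIV)) (\<lambda>_. count_space UNIV)"

definition transient_graph :: "'v set set \<Rightarrow> bool" where
  "transient_graph E \<longleftrightarrow> (\<forall>x. \<P>(\<omega> in srw E x. \<exists>n\<ge>1. \<omega> n = x) < 1)"

definition trajs :: "'v set set \<Rightarrow> (int \<Rightarrow> 'v) set" where
  "trajs E = {w. (\<forall>n. {w n, w (n + 1)} \<in> E) \<and> (\<forall>x. finite {n. w n = x})}"

definition traj_space :: "'v set set \<Rightarrow> (int \<Rightarrow> 'v) measure" where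
  "traj_space E = sigma (trajs E) {(\<lambda>w. w n) -` A \<inter> trajs E | n A. True}"

lemma space_traj_space: "space (traj_space E) = trajs E"
  unfolding traj_space_def by (rule space_measure_of) auto

lemma sets_traj_space_eq_restrict_space:
  "sets (traj_space E) = sets (restrict_space (PiM UNIV (\<lambda>_. count_space UNIV)) (trajs E))"
proof -
  let ?G = "{{f \<in> Pi\<^sub>E UNIV (\<lambda>_. UNIV). f n \<in> A} | (n :: int) A. n \<in> UNIV \<and> A \<in> Pow UNIV}"
  have "sets (restrict_space (PiM UNIV (\<lambda>_. count_space UNIV)) (trajs E))
      = (\<inter>) (trajs E) ` sigma_sets UNIV ?G"
    by (simp add: sets_restrict_space sets_PiM_single)
  also have "\<dots> = {(\<lambda>w. w) -` B \<inter> trajs E | B. B \<in> sigma_sets UNIV ?G}"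
    by auto
  also have "\<dots> = sigma_sets (trajs E) {(\<lambda>w. w) -` B \<inter> trajs E | B. B \<in> ?G}"
    by (rule sigma_sets_vimage_commute) auto
  also have "{(\<lambda>w. w) -` B \<inter> trajs E | B. B \<in> ?G} = {(\<lambda>w. w n) -` A \<inter> trajs E | n A. True}"
    (is "?L = ?R")
  proof
    show "?L \<subseteq> ?R"
      by (auto simp: vimage_def)
    show "?R \<subseteq> ?L"
    proof
      fix X assume "X \<in> ?R"
      then obtain n A where X: "X = (\<lambda>w. w n) -` A \<inter> trajs E" by auto
      have "{f \<in> Pi\<^sub>E UNIV (\<lambda>_. UNIV). f n \<in> A} \<in> ?G" by blast
      moreover have "X = (\<lambda>w. w) -` {f \<in> Pi\<^sub>E UNIV (\<lambda>_. UNIV). f n \<in> A} \<inter> trajs E"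
        by (auto simp: X)
      ultimately show "X \<in> ?L" by blast
    qed
  qed
  also have "sigma_sets (trajs E) \<dots> = sets (traj_space E)"
    unfolding traj_space_def by (rule sets_measure_of[symmetric]) auto
  finally show ?thesis ..
qed

definition shift_rel :: "'v set set \<Rightarrow> ((int \<Rightarrow> 'v) \<times> (int \<Rightarrow> 'v)) set" where
  "shift_rel E = {(w, w'). w \<in> trajs E \<and> w' \<in> trajs E \<and> (\<exists>k. \<forall>n. w n = w' (n + k))}"

definition trajs_star :: "'v set set \<Rightarrow> (int \<Rightarrow> 'v) set set" where
  "trajs_star E = trajs E // shift_rel E"

definition proj_star :: "'v set set \<Rightarrow> (int \<Rightarrow> 'v) \<Rightarrow> (int \<Rightarrow> 'v) set" where
  "proj_star E w = shift_rel E `` {w}"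

definition preimage_star :: "'v set set \<Rightarrow> (int \<Rightarrow> 'v) set set \<Rightarrow> (int \<Rightarrow> 'v) set" where
  "preimage_star E A = proj_star E -` A \<inter> trajs E"

definition sets_star :: "'v set set \<Rightarrow> (int \<Rightarrow> 'v) set set set" where
  "sets_star E = {A. A \<subseteq> trajs_star E \<and> preimage_star E A \<in> sets (traj_space E)}"

definition trajs_star_hitting :: "'v set set \<Rightarrow> 'v set \<Rightarrow> (int \<Rightarrow> 'v) set set" where
  "trajs_star_hitting E K = proj_star E ` {w \<in> trajs E. \<exists>n. w n \<in> K}"

definition glue_paths :: "(nat \<Rightarrow> 'v) \<times> (nat \<Rightarrow> 'v) \<Rightarrow> int \<Rightarrow> 'v" where
  "glue_paths p n = (if n \<ge> 0 then fst p (nat n) else snd p (nat (- n)))"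

text \<open>
  On a transient graph the glued path lies almost surely in \<open>trajs E\<close>, so that the
  restriction below is still a probability measure, namely the law \<open>P\<^sub>x\<^sup>\<plusminus>\<close> on \<open>trajs E\<close>.
\<close>

definition biinf_srw :: "'v set set \<Rightarrow> 'v \<Rightarrow> (int \<Rightarrow> 'v) measure" where
  "biinf_srw E x = restrict_space
     (distr (srw E x \<Otimes>\<^sub>M srw E x) (PiM UNIV (\<lambda>_. count_space UNIV)) glue_paths) (trajs E)"

lemma sets_biinf_srw: "sets (biinf_srw E x) = sets (traj_space E)"
  unfolding biinf_srw_def sets_traj_space_eq_restrict_space
  by (rule sets_restrict_space_cong) simp

definition hit_time :: "'v set \<Rightarrow> (int \<Rightarrow> 'v) \<Rightarrow> int" where
  "hit_time K w = Min {n. w n \<in> K}"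

text \<open>
  The requirement that \<open>w\<close> visits \<open>K\<close> is spelled out because \<open>hit_time K w\<close> is
  meaningful only then.
\<close>

definition Q_measure :: "'v set set \<Rightarrow> 'v set \<Rightarrow> (int \<Rightarrow> 'v) set \<Rightarrow> ennreal" where
  "Q_measure E K B =
     (\<Sum>x\<in>K. emeasure (biinf_srw E x) {w \<in> B. (\<exists>n. w n \<in> K) \<and> hit_time K w = 0})"

definition is_interlacement_intensity :: "'v set set \<Rightarrow> (int \<Rightarrow> 'v) set measure \<Rightarrow> bool" where
  "is_interlacement_intensity E \<nu> \<longleftrightarrow>
     space \<nu> = trajs_star E \<and> sets \<nu> = sets_star E \<and> sigma_finite_measure \<nu> \<and>
     (\<forall>A\<in>sets_star E. \<forall>K. finite K \<longrightarrow>
        emeasure \<nu> (A \<inter> trajs_star_hitting E K) = Q_measure E K (preimage_star E A))"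

end

theory Submission
  imports Defs
begin

text \<open>
  Let \<open>\<mu>\<close> be the law of the two-sided walk started from counting measure. It is invariant under
  automorphisms and, by reversibility, under time shifts. For a shift invariant set \<open>A\<close> of trajectories,
  mass transport over the time axis shows \<open>\<nu> (A) = \<integral>\<^sub>A h d\<mu>\<close> whenever \<open>h\<close> sums to 1 over the time
  shifts of almost every trajectory.

  If \<open>G\<close> is unimodular and \<open>Q\<close> existed, the mass transport in which \<open>x\<close> sends to \<open>y\<close> the
  \<open>Q\<close>-mass of the trajectories that visit \<open>x\<close> and are at \<open>y\<close> at time 0 would send out a finite mass
  but receive an infinite one.

  If \<open>G\<close> is not unimodular, let \<open>\<Delta> (x, y) = |\<Gamma>\<^sub>x y| / |\<Gamma>\<^sub>y x|\<close> be the modular cocycle and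
  \<open>m x = \<Delta> (x, o)\<close>. Then \<open>m\<close> is harmonic and not constant, so strict concavity of the square root makes
  \<open>g = sqrt m\<close> decay exponentially in mean along the walk, and \<open>g\<close> is summable along almost every
  trajectory. Automorphisms multiply \<open>g\<close> by constants, so \<open>h w = g (w 0) / (\<Sum>n. g (w n))\<close> is invariant,
  and \<open>Q\<close> is \<open>\<mu>\<close> with density \<open>h\<close>.
\<close>

section \<open>Cylinder sets and the law of simple random walk\<close>

text \<open>A lift \<open>Q\<close> amounts to choosing, possibly at random, a time origin on every
  trajectory class, equivariantly under automorphisms. The walk from counting measure treats all
  origins alike, so the orbit sum over time gives each class infinite weight; a density has to
  single out origins without singling out vertices. A positive vertex function that is canonical
  only up to a constant factor is enough for this, because the factor cancels in a ratio. The
  modular weight is of this kind: moving the base point multiplies it by a constant. Harmonicity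
  alone does not make it summable: its mean along the walk is constant, so its expected sum over
  time is infinite. Passing to the square root turns the eigenvalue 1 into an eigenvalue below 1. In
  terms of Haar measure the modular cocycle is the ratio of the masses of two stabilizers. All its
  properties are obtained here from cardinalities of finite orbits, so that no topology on the
  automorphism group enters. The walk measure is infinite, so measures are compared through
  cylinders of finite mass rather than through total mass.\<close>

lemma measure_eq_on_cylinders:
  fixes M N :: "('i \<Rightarrow> 'v) measure" and I :: "nat \<Rightarrow> 'i set"
  assumes countable: "countable (UNIV :: 'v set)"
    and fin: "\<And>n. finite (I n)" and mono: "incseq I" and un: "(\<Union>n. I n) = UNIV"
    and sets: "sets M = sets (PiM UNIV (\<lambda>_. count_space UNIV))"
      "sets N = sets (PiM UNIV (\<lambda>_. count_space UNIV))"
    and eq: "\<And>n a. emeasure M {w. \<forall>i\<in>I n. w i = a i} = emeasure N {w. \<forall>i\<in>I n. w i = a i}"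
    and finite: "\<And>a. emeasure M {w. \<forall>i\<in>I 0. w i = a i} \<noteq> \<infinity>"
  shows "M = N"
proof -
  define C where "C n a = {w :: 'i \<Rightarrow> 'v. \<forall>i\<in>I n. w i = a i}" for n a
  define G where "G = insert {} {C n a | n a. True}"
  \<comment> \<open>The windows increase, so two cylinders are either disjoint or nested. Adding the
    empty set therefore already gives an intersection-stable generator.\<close>
  have le: "C n a \<inter> C m b = {} \<or> C n a \<inter> C m b = C m b" if "n \<le> m" for n m a b
    using incseqD[OF mono that] unfolding C_def by fastforce
  have stable: "Int_stable G"
  proof (rule Int_stableI)
    fix a b assume "a \<in> G" "b \<in> G"
    then show "a \<inter> b \<in> G"
    proof (cases "a = {} \<or> b = {}")
      case False
      with \<open>a \<in> G\<close> \<open>b \<in> G\<close> obtain n c m d where "a = C n c" "b = C m d" by (auto simp: G_def)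
      then show ?thesis using le[of n m c d] le[of m n d c]
        by (cases "n \<le> m") (auto simp: G_def Int_commute)
    qed (auto simp: G_def)
  qed
  have "C n a = prod_emb UNIV (\<lambda>_. count_space UNIV) (I n) (PiE (I n) (\<lambda>i. {a i}))" for n a
    by (auto simp: C_def prod_emb_def restrict_def PiE_iff extensional_def)
  then have C_sets: "C n a \<in> sets (PiM UNIV (\<lambda>_. count_space UNIV))" for n a
    using sets_PiM_I[of "I n" UNIV "\<lambda>i. {a i}" "\<lambda>_. count_space UNIV"] fin by simp
  define R where "R n = (PiE (I n) (\<lambda>_. UNIV) :: ('i \<Rightarrow> 'v) set)" for n
  have countR: "countable (R n)" for n
    unfolding R_def using fin countable by (intro countable_PiE) auto
  have eval: "{w. w i \<in> A} \<in> sigma_sets UNIV G" for i A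
  proof -
    obtain n where n: "i \<in> I n" using un by blast
    \<comment> \<open>Countability of the vertex set enters here: an event about one coordinate
      splits into countably many cylinders.\<close>
    have "{w. w i \<in> A} = (\<Union>a\<in>{a\<in>R n. a i \<in> A}. C n a)"
    proof (intro set_eqI iffI)
      fix w :: "'i \<Rightarrow> 'v" assume "w \<in> {w. w i \<in> A}"
      then have "restrict w (I n) \<in> {a\<in>R n. a i \<in> A}" "w \<in> C n (restrict w (I n))"
        using n by (auto simp: R_def C_def)
      then show "w \<in> (\<Union>a\<in>{a\<in>R n. a i \<in> A}. C n a)" by blast
    qed (use n in \<open>auto simp: C_def\<close>)
    moreover have "countable {a\<in>R n. a i \<in> A}"
      by (rule countable_subset[OF _ countR[of n]]) auto
    moreover have "C n a \<in> sigma_sets UNIV G" for a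
      by (rule sigma_sets.Basic) (auto simp: G_def)
    ultimately show ?thesis
      by (auto intro!: sigma_sets_UNION)
  qed
  have gen: "sets (PiM UNIV (\<lambda>_. count_space UNIV :: 'v measure)) = sigma_sets (UNIV :: ('i \<Rightarrow> 'v) set) G"
  proof
    show "sets (PiM UNIV (\<lambda>_. count_space UNIV :: 'v measure)) \<subseteq> sigma_sets (UNIV :: ('i \<Rightarrow> 'v) set) G"
      unfolding sets_PiM_single by (simp, rule sigma_sets_mono) (auto simp: eval)
    show "sigma_sets (UNIV :: ('i \<Rightarrow> 'v) set) G \<subseteq> sets (PiM UNIV (\<lambda>_. count_space UNIV :: 'v measure))"
    proof -
      have "sigma_sets (space (PiM (UNIV :: 'i set) (\<lambda>_. count_space UNIV :: 'v measure))) G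
          \<subseteq> sets (PiM UNIV (\<lambda>_. count_space UNIV))"
        by (rule sets.sigma_sets_subset) (use C_sets in \<open>auto simp: G_def\<close>)
      then show ?thesis by (simp add: space_PiM)
    qed
  qed
  show ?thesis
  \<comment> \<open>The cylinders over the smallest window form a countable cover of finite mass,
    which replaces finiteness of the measures.\<close>
  proof (rule measure_eqI_generator_eq_countable[where E=G and \<Omega>=UNIV and A="C 0 ` R 0"])
    show "\<Union> (C 0 ` R 0) = UNIV"
    proof (intro set_eqI iffI)
      fix w :: "'i \<Rightarrow> 'v"
      have "restrict w (I 0) \<in> R 0" "w \<in> C 0 (restrict w (I 0))"
        by (auto simp: R_def C_def)
      then show "w \<in> \<Union> (C 0 ` R 0)" by blast
    qed simp
    show "C 0 ` R 0 \<subseteq> G" by (auto simp: G_def)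
  qed (use stable sets gen eq finite countR in \<open>auto simp: G_def C_def\<close>)
qed

abbreviation step_law :: "'v set set \<Rightarrow> 'v \<Rightarrow> 'v pmf" where
  "step_law E x \<equiv> pmf_of_set (nbrs E x)"

abbreviation path_space :: "('i \<Rightarrow> 'v) measure" where
  "path_space \<equiv> PiM UNIV (\<lambda>_. count_space UNIV)"

lemma sets_srw [measurable_cong]: "sets (srw E x) = sets path_space"
proof -
  interpret Ionescu_Tulcea "srw_kernel E x" "\<lambda>_. count_space UNIV"
    by (rule Ionescu_Tulcea_srw_kernel)
  show ?thesis by (simp add: srw_def PF.sets_lim)
qed

text \<open>The finite-dimensional laws live on restricted paths, where a cylinder becomes a single
  point whose mass factors kernel by kernel. The kernel at time 0 is the point mass at
  \<open>x\<close> and yields the indicator; the \<open>n\<close> transitions involve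
  \<open>n + 1\<close> positions, hence \<open>{0..<Suc n}\<close>.\<close>

lemma emeasure_srw_cylinder:
  fixes x :: 'v
  shows "emeasure (srw E x) {\<omega>. \<forall>i\<in>{..n}. \<omega> i = a i} =
    indicator {x} (a 0) * (\<Prod>i<n. ennreal (pmf (step_law E (a i)) (a (Suc i))))"
proof -
  interpret Ionescu_Tulcea "srw_kernel E x" "\<lambda>_. count_space UNIV"
    by (rule Ionescu_Tulcea_srw_kernel)
  have pt: "{restrict a J} \<in> sets (PiM J (\<lambda>_. count_space (UNIV :: 'v set)))" if "finite J" for J :: "nat set"
  proof -
    have "{restrict a J} = PiE J (\<lambda>i. {a i})"
      by (auto simp: PiE_iff extensional_def restrict_def fun_eq_iff)
    then show ?thesis using that by (simp add: sets_PiM_I_finite)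
  qed
  have C: "emeasure (C 0 n (\<lambda>_. undefined)) {restrict a {0..<n}} = (\<Prod>i<n. emeasure (srw_kernel E x i a) {a i})" for n
  proof (induction n)
    case 0
    then show ?case by (simp add: PiM_empty)
  next
    case (Suc n)
    have "emeasure (C 0 (Suc n) (\<lambda>_. undefined)) {restrict a {0..<Suc n}}
       = (\<integral>\<^sup>+ \<omega>. emeasure (eP n \<omega>) {restrict a {0..<Suc n}} \<partial>C 0 n (\<lambda>_. undefined))"
    proof -
      have "eP n \<in> measurable (C 0 n (\<lambda>_. undefined)) (subprob_algebra (PiM {0..<Suc n} (\<lambda>_. count_space UNIV)))"
        using measurable_eP[of n] by (subst measurable_cong_sets[OF sets_C refl]) (auto simp: space_PiM)
      moreover have "space (C 0 n (\<lambda>_. undefined)) \<noteq> {}"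
        by (subst space_C) (auto simp: space_PiM PiE_eq_empty_iff)
      ultimately show ?thesis
        using pt[of "{0..<Suc n}"] by (simp add: emeasure_bind)
    qed
    also have "\<dots> = (\<integral>\<^sup>+ \<omega>. emeasure (srw_kernel E x n a) {a n} * indicator {restrict a {0..<n}} \<omega> \<partial>C 0 n (\<lambda>_. undefined))"
    proof (rule nn_integral_cong)
      fix \<omega> assume "\<omega> \<in> space (C 0 n (\<lambda>_. undefined))"
      then have \<omega>: "\<omega> \<in> space (PiM {0..<n} (\<lambda>_. count_space UNIV))" by (simp add: space_C)
      \<comment> \<open>Appending a vertex to \<open>\<omega>\<close> can give the prescribed path
        only if \<open>\<omega>\<close> is already its initial piece.\<close>
      have *: "(\<lambda>y. fun_upd \<omega> n y) -` {restrict a {0..<Suc n}} = (if \<omega> = restrict a {0..<n} then {a n} else {})"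
        using \<omega> by (auto simp: fun_eq_iff space_PiM PiE_iff extensional_def restrict_def split: if_splits)
           (metis less_SucE  less_Suc_eq nat_neq_iff)+
      have "srw_kernel E x n (restrict a {0..<n}) = srw_kernel E x n a"
        by (auto simp: srw_kernel_def split: nat.split)
      then show "emeasure (eP n \<omega>) {restrict a {0..<Suc n}} = emeasure (srw_kernel E x n a) {a n} * indicator {restrict a {0..<n}} \<omega>"
        using \<omega> pt[of "{0..<Suc n}"] by (simp add: emeasure_eP *)
    qed
    also have "\<dots> = emeasure (srw_kernel E x n a) {a n} * emeasure (C 0 n (\<lambda>_. undefined)) {restrict a {0..<n}}"
      using pt[of "{0..<n}"] by (subst nn_integral_cmult_indicator) (auto simp: sets_C space_PiM)
    finally show ?case
      unfolding Suc by (simp only: prod.lessThan_Suc mult.commute)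
  qed
  have "{\<omega>. \<forall>i\<in>{..n}. \<omega> i = a i} = PF.emb UNIV {0..<Suc n} {restrict a {0..<Suc n}}"
    by (auto simp: prod_emb_def restrict_def fun_eq_iff) (metis less_Suc_eq_le)
  then have "emeasure (srw E x) {\<omega>. \<forall>i\<in>{..n}. \<omega> i = a i} = emeasure (CI {0..<Suc n}) {restrict a {0..<Suc n}}"
    using pt[of "{0..<Suc n}"] by (simp add: srw_def lim)
  also have "\<dots> = emeasure (C 0 (Suc n) (\<lambda>_. undefined)) {restrict a {0..<Suc n}}"
    using pt[of "{0..<Suc n}"] by (subst emeasure_CI[where n="Suc n"]) (auto simp: prod_emb_id extensional_def restrict_def space_PiM PiE_iff)
  also have "\<dots> = indicator {x} (a 0) * (\<Prod>i<n. ennreal (pmf (step_law E (a i)) (a (Suc i))))"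
    unfolding C by (simp add: prod.lessThan_Suc_shift srw_kernel_def emeasure_pmf_single indicator_def del: prod.lessThan_Suc)
  finally show ?thesis .
qed

text \<open>The limit has the total mass of any of its finite marginals; the marginal on the empty
  index set is the simplest one, since its embedding is the whole space.\<close>

lemma prob_space_srw: "prob_space (srw E x)"
proof -
  interpret Ionescu_Tulcea "srw_kernel E x" "\<lambda>_. count_space UNIV"
    by (rule Ionescu_Tulcea_srw_kernel)
  have space_CI: "space (CI {}) = {\<lambda>_. undefined}"
    by (simp add: CI_def space_PiM)
  have "emeasure (CI {}) (space (CI {})) = 1"
    by (rule prob_space.emeasure_space_1) (rule PF.prob_space_P, auto)
  then have "emeasure PF.lim (PF.emb UNIV {} (space (CI {}))) = 1"
    by (subst lim) (auto simp: space_CI PiM_empty)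
  moreover have "PF.emb UNIV {} (space (CI {})) = space PF.lim"
    by (auto simp: prod_emb_def space_CI PF.space_lim space_PiM)
  ultimately show ?thesis unfolding srw_def by (intro prob_spaceI) simp
qed

lemma path_evaluation_measurable [measurable]:
  "(\<lambda>w. w i) \<in> measurable path_space (count_space UNIV)"
  by (rule measurable_component_singleton) simp

lemma cylinder_in_sets:
  assumes "finite I"
  shows "{w. \<forall>i\<in>I. w i = a i} \<in> sets path_space"
proof -
  have "{w. \<forall>i\<in>I. w i = a i} = prod_emb UNIV (\<lambda>_. count_space UNIV) I (PiE I (\<lambda>i. {a i}))"
    by (auto simp: prod_emb_def restrict_def PiE_iff extensional_def)
  then show ?thesis
    using sets_PiM_I[of I UNIV "\<lambda>i. {a i}" "\<lambda>_. count_space UNIV"] assms by simp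
qed

lemma space_srw [simp]: "space (srw E x) = UNIV"
  using sets_eq_imp_space_eq[OF sets_srw, of E x] by (simp add: space_PiM)

lemma measurable_case_nat_path [measurable]:
  "(\<lambda>\<omega>. case_nat x \<omega>) \<in> measurable path_space path_space"
proof (rule measurable_PiM_single')
  show "(\<lambda>\<omega>. case_nat x \<omega> i) \<in> measurable path_space (count_space UNIV)" for i
    by (cases i) auto
qed auto

section \<open>Transitive graphs\<close>

locale transitive_network =
  fixes E :: "'v set set"
  assumes simple: "simple_graph E" and lf: "locally_finite_graph E"
    and conn: "connected_graph E" and transitive: "transitive_graph E"
    and transient: "transient_graph E"
begin

abbreviation "\<Gamma> \<equiv> graph_aut E"

lemma finite_nbrs: "finite (nbrs E x)"
  using lf by (auto simp: locally_finite_graph_def)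

lemma connected: "(x, y) \<in> {(u, v). {u, v} \<in> E}\<^sup>*"
  using conn by (auto simp: connected_graph_def)

lemma finite_reachable: "finite {y. (x, y) \<in> {(u, v). {u, v} \<in> E} ^^ n}" (is "finite {y. _ \<in> ?R ^^ n}")
proof (induction n)
  case (Suc n)
  have "{y. (x, y) \<in> ?R ^^ Suc n} = (\<Union>z\<in>{y. (x, y) \<in> ?R ^^ n}. nbrs E z)"
    by (auto simp: nbrs_def relcomp_unfold)
  then show ?case using Suc finite_nbrs by simp
qed simp

lemma countable_vertices: "countable (UNIV :: 'v set)"
proof -
  fix x :: 'v
  have "UNIV = (\<Union>n. {y. (x, y) \<in> {(u, v). {u, v} \<in> E} ^^ n})"
    using connected by (auto simp: rtrancl_power)
  also have "countable \<dots>"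
    using finite_reachable by (auto intro: countable_finite)
  finally show ?thesis .
qed

lemma srw_not_sure_return: "measure (srw E x) {\<omega>. \<exists>n\<ge>1. \<omega> n = x} < 1"
  using transient by (auto simp: transient_graph_def)

text \<open>By connectedness an isolated vertex is the whole graph. The walk then has nowhere else
  to be, so it returns with probability 1, against transience.\<close>

lemma nbrs_nonempty: "nbrs E x \<noteq> {}"
proof
  assume empty: "nbrs E x = {}"
  have "y = x" for y
    using connected[of x y] empty by (cases rule: converse_rtranclE) (auto simp: nbrs_def)
  then have "{\<omega> :: nat \<Rightarrow> 'v. \<exists>n\<ge>1. \<omega> n = x} = UNIV" by blast
  then show False
    using srw_not_sure_return[of x] prob_space.prob_space[OF prob_space_srw, of E x] by simp
qed

lemma aut_inv: "\<phi> \<in> \<Gamma> \<Longrightarrow> inv \<phi> \<in> \<Gamma>"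
  unfolding graph_aut_def by (auto simp: bij_imp_bij_inv) (metis bij_inv_eq_iff)+

lemma aut_comp: "\<phi> \<in> \<Gamma> \<Longrightarrow> \<psi> \<in> \<Gamma> \<Longrightarrow> \<phi> \<circ> \<psi> \<in> \<Gamma>"
  unfolding graph_aut_def by (auto intro: bij_comp)

lemma aut_bij: "\<phi> \<in> \<Gamma> \<Longrightarrow> bij \<phi>"
  by (simp add: graph_aut_def)

lemma aut_id: "id \<in> \<Gamma>"
  by (simp add: graph_aut_def)

lemma aut_eq_iff: "\<phi> \<in> \<Gamma> \<Longrightarrow> \<phi> x = \<phi> y \<longleftrightarrow> x = y"
  by (auto dest!: aut_bij bij_is_inj simp: inj_eq)

lemma aut_inv_apply: "\<phi> \<in> \<Gamma> \<Longrightarrow> inv \<phi> (\<phi> x) = x" "\<phi> \<in> \<Gamma> \<Longrightarrow> \<phi> (inv \<phi> x) = x"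
  by (auto dest!: aut_bij simp: bij_is_inj bij_is_surj surj_f_inv_f)

lemma aut_edge: "\<phi> \<in> \<Gamma> \<Longrightarrow> {\<phi> x, \<phi> y} \<in> E \<longleftrightarrow> {x, y} \<in> E"
  by (simp add: graph_aut_def)

lemma transitiveE: obtains \<phi> where "\<phi> \<in> \<Gamma>" "\<phi> x = y"
  using transitive by (auto simp: transitive_graph_def)

lemma aut_nbrs: "\<phi> \<in> \<Gamma> \<Longrightarrow> nbrs E (\<phi> x) = \<phi> ` nbrs E x"
proof (intro set_eqI iffI)
  fix y assume \<phi>: "\<phi> \<in> \<Gamma>" and "y \<in> nbrs E (\<phi> x)"
  then have "inv \<phi> y \<in> nbrs E x" "y = \<phi> (inv \<phi> y)"
    using aut_edge[OF \<phi>, of x "inv \<phi> y"] by (auto simp: nbrs_def aut_inv_apply)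
  then show "y \<in> \<phi> ` nbrs E x" by blast
qed (auto simp: nbrs_def aut_edge)

definition deg :: nat where "deg = card (nbrs E undefined)"

lemma sum_nbrs_aut:
  assumes "\<phi> \<in> \<Gamma>"
  shows "(\<Sum>y\<in>nbrs E (\<phi> x). f y) = (\<Sum>y\<in>nbrs E x. f (\<phi> y))"
  unfolding aut_nbrs[OF assms]
  by (rule sum.reindex_cong[where l=\<phi>]) (auto intro!: inj_onI simp: aut_eq_iff[OF assms])

lemma card_nbrs: "card (nbrs E x) = deg"
proof -
  obtain \<phi> where \<phi>: "\<phi> \<in> \<Gamma>" "\<phi> undefined = x" by (rule transitiveE)
  show ?thesis using sum_nbrs_aut[OF \<phi>(1), of "\<lambda>_. 1::nat" undefined] \<phi> by (simp add: deg_def)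
qed

lemma deg_pos: "deg > 0"
  using nbrs_nonempty finite_nbrs card_nbrs by (metis card_gt_0_iff)

lemma pmf_step_law: "pmf (step_law E x) y = indicator (nbrs E x) y / real deg"
  by (simp add: pmf_of_set finite_nbrs nbrs_nonempty card_nbrs)

text \<open>All degrees agree, so the transition probabilities are symmetric. This is the
  reversibility with respect to counting measure on which shift invariance rests.\<close>

lemma pmf_step_law_sym: "pmf (step_law E x) y = pmf (step_law E y) x"
  unfolding pmf_step_law by (auto simp: nbrs_def insert_commute indicator_def)

lemma pmf_step_law_aut: "\<phi> \<in> \<Gamma> \<Longrightarrow> pmf (step_law E (\<phi> x)) (\<phi> y) = pmf (step_law E x) y"
  unfolding pmf_step_law by (auto simp: nbrs_def aut_edge indicator_def)

section \<open>First-step decomposition of simple random walk\<close>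

lemma nn_integral_step_law:
  "(\<integral>\<^sup>+ y. f y \<partial>step_law E x) = (\<Sum>y\<in>nbrs E x. f y) / of_nat deg"
  by (simp add: nn_integral_pmf_of_set finite_nbrs nbrs_nonempty card_nbrs)

lemma measurable_srw_prepend:
  "(\<lambda>y. distr (srw E y) path_space (case_nat x)) \<in>
    measurable (measure_pmf (step_law E x)) (subprob_algebra path_space)"
  by (simp add: measurable_def space_subprob_algebra)
     (auto intro!: prob_space_imp_subprob_space prob_space.prob_space_distr prob_space_srw)

text \<open>The Markov property at time 1. Both sides are compared on cylinders
  \<open>{..n}\<close>: for \<open>n = 0\<close> only the start matters, and for
  \<open>n = Suc m\<close> the first factor of the product formula splits off.\<close>

lemma srw_first_step:
  "srw E x = measure_pmf (step_law E x) \<bind> (\<lambda>y. distr (srw E y) path_space (case_nat x))"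
    (is "_ = ?R")
proof (rule measure_eq_on_cylinders[where I="\<lambda>n. {..n}"])
  show "sets ?R = sets path_space"
    by (rule sets_bind) auto
  have em: "emeasure ?R A = (\<integral>\<^sup>+ y. emeasure (srw E y) {\<omega>. case_nat x \<omega> \<in> A} \<partial>step_law E x)"
    if "A \<in> sets path_space" for A
    using that by (subst emeasure_bind[OF _ measurable_srw_prepend]) (auto intro!: nn_integral_cong simp: emeasure_distr vimage_def)
  show "emeasure (srw E x) {w. \<forall>i\<in>{..n}. w i = a i} = emeasure ?R {w. \<forall>i\<in>{..n}. w i = a i}" for n a
  proof (cases n)
    case 0
    have "{\<omega>. \<forall>i\<in>{..n}. case_nat x \<omega> i = a i} = (if x = a 0 then UNIV else {})"
      using 0 by auto
    moreover have "{w :: nat \<Rightarrow> 'v. w 0 = a 0} \<in> sets path_space"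
      using cylinder_in_sets[of "{0::nat}" a] by simp
    ultimately show ?thesis
      by (auto simp: em cylinder_in_sets 0 emeasure_srw_cylinder[where n=0 and a=a, simplified] indicator_def
         prob_space.emeasure_space_1[OF prob_space_srw, simplified])
  next
    case (Suc m)
    let ?p = "\<Prod>i<m. ennreal (pmf (step_law E (a (Suc i))) (a (Suc (Suc i))))"
    have "{\<omega>. \<forall>i\<in>{..n}. case_nat x \<omega> i = a i} = (if x = a 0 then {\<omega>. \<forall>i\<in>{..m}. \<omega> i = a (Suc i)} else {})"
      unfolding Suc by (auto simp: less_Suc_eq_0_disj split: nat.splits)
    then have "emeasure ?R {w. \<forall>i\<in>{..n}. w i = a i}
       = (\<integral>\<^sup>+ y. indicator {x} (a 0) * ?p * indicator {a 1} y \<partial>step_law E x)"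
      by (subst em, simp add: cylinder_in_sets, intro nn_integral_cong)
         (auto simp: emeasure_srw_cylinder[where a="\<lambda>i. a (Suc i)"] split: split_indicator)
    also have "\<dots> = indicator {x} (a 0) * ?p * pmf (step_law E x) (a 1)"
      by (subst nn_integral_cmult_indicator) (auto simp: emeasure_pmf_single)
    also have "\<dots> = emeasure (srw E x) {w. \<forall>i\<in>{..n}. w i = a i}"
      unfolding emeasure_srw_cylinder Suc
      by (auto simp: prod.lessThan_Suc_shift indicator_def mult.commute simp del: prod.lessThan_Suc)
    finally show ?thesis ..
  qed
  show "emeasure (srw E x) A \<noteq> \<infinity>" for A
    using prob_space.emeasure_le_1[OF prob_space_srw, of E x A] by (auto simp: top_unique)
qed (auto simp: countable_vertices sets_srw incseq_def)

lemma nn_integral_srw_first_step: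
  assumes [measurable]: "f \<in> borel_measurable path_space"
  shows "(\<integral>\<^sup>+ \<omega>. f \<omega> \<partial>srw E x) =
    (\<Sum>y\<in>nbrs E x. \<integral>\<^sup>+ \<omega>. f (case_nat x \<omega>) \<partial>srw E y) / of_nat deg"
  by (subst srw_first_step, subst nn_integral_bind[OF _ measurable_srw_prepend])
     (simp_all add: nn_integral_distr nn_integral_step_law)

lemma emeasure_srw_first_step:
  assumes [measurable]: "A \<in> sets path_space"
  shows "emeasure (srw E x) A = (\<Sum>y\<in>nbrs E x. emeasure (srw E y) {\<omega>. case_nat x \<omega> \<in> A}) / of_nat deg"
proof -
  have "{\<omega>. case_nat x \<omega> \<in> A} \<in> sets path_space"
    using measurable_sets[OF measurable_case_nat_path assms, of x]
    by (simp add: vimage_def space_PiM)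
  moreover have *: "(indicator A (case_nat x \<omega>) :: ennreal) = indicator {\<omega>. case_nat x \<omega> \<in> A} \<omega>" for \<omega>
    by (simp add: indicator_def)
  ultimately show ?thesis
    using nn_integral_srw_first_step[of "indicator A" x] assms
    by (simp add: * sets_srw)
qed

lemma srw_start: "AE \<omega> in srw E x. \<omega> 0 = x"
proof -
  have "emeasure (srw E x) {\<omega>. \<omega> 0 = x} = 1"
    using emeasure_srw_cylinder[where n=0 and a="\<lambda>_. x"] by simp
  then show ?thesis
    by (subst prob_space.AE_iff_emeasure_eq_1[OF prob_space_srw]) simp_all
qed


section \<open>Transience\<close>

lemma emeasure_srw_shifted:
  assumes "{\<omega>. P \<omega>} \<in> sets path_space"
  shows "emeasure (srw E x) {\<omega>. P (\<lambda>n. \<omega> (Suc n))} = (\<Sum>y\<in>nbrs E x. emeasure (srw E y) {\<omega>. P \<omega>}) / of_nat deg"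
proof -
  have shift: "(\<lambda>\<omega> n. \<omega> (Suc n)) \<in> measurable path_space (path_space :: (nat \<Rightarrow> 'v) measure)"
    by (rule measurable_PiM_single') auto
  have "{\<omega>. P (\<lambda>n. \<omega> (Suc n))} \<in> sets path_space"
    using measurable_sets[OF shift assms] by (simp add: vimage_def space_PiM)
  from emeasure_srw_first_step[OF this] show ?thesis by simp
qed

lemma visit_sets: "{\<omega>. \<omega> n = x} \<in> sets path_space"
  "{\<omega>. \<exists>n\<le>N. \<omega> n = x} \<in> sets path_space"
  for n N :: nat and x :: 'v
proof -
  have "Measurable.pred path_space (\<lambda>\<omega>. \<omega> n = x)" for n by measurable
  then show *: "{\<omega>. \<omega> n = x} \<in> sets path_space" for n by (simp add: pred_def space_PiM)
  have "{\<omega>. \<exists>n\<le>N. \<omega> n = x} = (\<Union>n\<le>N. {\<omega>. \<omega> n = x})" by auto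
  then show "{\<omega>. \<exists>n\<le>N. \<omega> n = x} \<in> sets path_space"
    using * by (simp only:) (intro sets.finite_UN, auto)
qed

lemma emeasure_srw_start: "emeasure (srw E z) {\<omega>. \<omega> 0 = x} = indicator {x} z"
  using emeasure_srw_cylinder[where n=0 and a="\<lambda>_. x"] by (simp add: indicator_def)

text \<open>
  Summing the first-step equation gives \<open>green x N z \<le> hit_prob x N z * green x N x\<close>, which bounds the
  expected number of visits by \<open>1 / (1 - u)\<close> with \<open>u < 1\<close> the return probability, without a renewal
  argument.
\<close>

definition green :: "'v \<Rightarrow> nat \<Rightarrow> 'v \<Rightarrow> ennreal" where
  "green x N z = (\<Sum>n\<le>N. emeasure (srw E z) {\<omega>. \<omega> n = x})"

definition hit_prob :: "'v \<Rightarrow> nat \<Rightarrow> 'v \<Rightarrow> ennreal" where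
  "hit_prob x N z = emeasure (srw E z) {\<omega>. \<exists>n\<le>N. \<omega> n = x}"

lemma green_Suc:
  "green x (Suc N) z = indicator {x} z + (\<Sum>y\<in>nbrs E z. green x N y) / of_nat deg"
proof -
  have "green x (Suc N) z = indicator {x} z + (\<Sum>n\<le>N. emeasure (srw E z) {\<omega>. \<omega> (Suc n) = x})"
    unfolding green_def by (simp add: sum.atMost_Suc_shift emeasure_srw_start del: sum.atMost_Suc)
  also have "(\<Sum>n\<le>N. emeasure (srw E z) {\<omega>. \<omega> (Suc n) = x}) = (\<Sum>y\<in>nbrs E z. green x N y) / of_nat deg"
    unfolding green_def
    by (simp add: emeasure_srw_shifted[where P="\<lambda>\<omega>. \<omega> n = x" for n] visit_sets sum.swap[of _ "{..N}"]
      divide_ennreal_def sum_distrib_right[symmetric])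
  finally show ?thesis .
qed

lemma sum_hit_prob:
  "(\<Sum>y\<in>nbrs E z. hit_prob x N y * c) / of_nat deg = emeasure (srw E z) {\<omega>. \<exists>n\<le>N. \<omega> (Suc n) = x} * c"
  unfolding hit_prob_def emeasure_srw_shifted[where P="\<lambda>\<omega>. \<exists>n\<le>N. \<omega> n = x", OF visit_sets(2)]
    sum_distrib_right[symmetric] divide_ennreal_def by (simp only: mult_ac)

lemma green_le_start: "green x N x \<le> hit_prob x N x * green x N x"
proof -
  have "emeasure (srw E x) {\<omega>. \<omega> 0 = x} \<le> hit_prob x N x"
    unfolding hit_prob_def by (rule emeasure_mono) (auto simp: sets_srw visit_sets)
  then have "1 \<le> hit_prob x N x" by (simp add: emeasure_srw_start)
  from mult_right_mono[OF this, of "green x N x"] show ?thesis by simp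
qed

text \<open>Away from \<open>x\<close> the Green function has no source term, so the bound is
  inherited from the neighbours by averaging. At \<open>x\<close> itself the hitting probability is
  at least 1 and there is nothing to prove; a neighbour may be \<open>x\<close>, so the induction
  step needs both cases.\<close>

lemma green_le: "green x N z \<le> hit_prob x N z * green x N x"
proof (cases "z = x")
  case True
  then show ?thesis using green_le_start[of x N] by simp
next
  case False
  then show ?thesis
  proof (induction N arbitrary: z)
    case 0
    then show ?case by (simp add: green_def emeasure_srw_start)
  next
    case (Suc N)
    have le: "green x N y \<le> hit_prob x N y * green x N x" for y
    proof (cases "y = x")
      case True
      then show ?thesis using green_le_start[of x N] by simp
    qed (rule Suc)
    have "green x (Suc N) z = (\<Sum>y\<in>nbrs E z. green x N y) / of_nat deg"
      using Suc.prems by (simp add: green_Suc)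
    also have "\<dots> \<le> (\<Sum>y\<in>nbrs E z. hit_prob x N y * green x N x) / of_nat deg"
      by (intro divide_right_mono_ennreal sum_mono le)
    also have "\<dots> = emeasure (srw E z) {\<omega>. \<exists>n\<le>N. \<omega> (Suc n) = x} * green x N x"
      by (rule sum_hit_prob)
    also have "\<dots> \<le> hit_prob x (Suc N) z * green x (Suc N) x"
      unfolding hit_prob_def green_def
      by (intro mult_mono emeasure_mono sum_mono2) (auto simp: sets_srw visit_sets)
    finally show ?case .
  qed
qed

lemma AE_finite_visits: "AE \<omega> in srw E z. finite {n. \<omega> n = x}"
proof -
  define u where "u = measure (srw E x) {\<omega>. \<exists>n\<ge>1. \<omega> n = x}"
  have u: "u < 1" "0 \<le> u" using srw_not_sure_return unfolding u_def by auto
  interpret X: prob_space "srw E x" by (rule prob_space_srw)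
  interpret Z: prob_space "srw E z" by (rule prob_space_srw)
  have "{\<omega> :: nat \<Rightarrow> 'v. \<exists>n\<ge>1. \<omega> n = x} = (\<Union>n\<in>{1..}. {\<omega>. \<omega> n = x})" by auto
  then have sets_u: "{\<omega> :: nat \<Rightarrow> 'v. \<exists>n\<ge>1. \<omega> n = x} \<in> sets path_space"
    by (simp only:) (intro sets.countable_UN', auto simp: visit_sets)
  have bound: "green x N x \<le> ennreal (1 / (1 - u))" for N
  proof -
    \<comment> \<open>Truncation at \<open>N\<close> gives a crude finite bound. Without it the
      inequality \<open>G \<le> 1 + u * G\<close> could not be solved for \<open>G\<close>.\<close>
    have "green x N x \<le> (\<Sum>n\<le>N. 1)"
      unfolding green_def by (intro sum_mono) (rule X.emeasure_le_1)
    also have "\<dots> < \<top>" by (simp add: of_nat_less_top)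
    finally obtain G where G: "green x N x = ennreal G" "0 \<le> G" 
      by (cases "green x N x") auto
    \<comment> \<open>One more step exposes the source term 1 at \<open>x\<close>; the remaining
      term involves only visits at positive times, so the return probability \<open>u\<close> bounds
      it.\<close>
    have "green x N x \<le> green x (Suc N) x" unfolding green_def by (intro sum_mono2) auto
    also have "\<dots> = 1 + (\<Sum>y\<in>nbrs E x. green x N y) / of_nat deg"
      by (simp add: green_Suc)
    also have "\<dots> \<le> 1 + (\<Sum>y\<in>nbrs E x. hit_prob x N y * green x N x) / of_nat deg"
      by (intro divide_right_mono_ennreal sum_mono add_left_mono green_le)
    also have "\<dots> = 1 + emeasure (srw E x) {\<omega>. \<exists>n\<le>N. \<omega> (Suc n) = x} * green x N x"
      by (simp only: sum_hit_prob)
    also have "\<dots> \<le> 1 + emeasure (srw E x) {\<omega>. \<exists>n\<ge>1. \<omega> n = x} * green x N x"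
      by (intro add_left_mono mult_right_mono emeasure_mono) (auto simp: sets_srw sets_u[simplified])
    also have "\<dots> = ennreal (1 + u * G)"
      using u G by (simp only: X.emeasure_eq_measure u_def[symmetric]) (simp add: ennreal_mult ennreal_plus)
    finally have "ennreal G \<le> ennreal (1 + u * G)" by (simp only: G)
    then have "G \<le> 1 + u * G" using G u by (subst (asm) ennreal_le_iff) auto
    then have "G \<le> 1 / (1 - u)" using u by (simp add: field_simps)
    then show ?thesis using G by (simp add: ennreal_leI)
  qed
  have "summable (\<lambda>n. measure (srw E z) {\<omega>. \<omega> n = x})"
  proof (rule bounded_imp_summable)
    fix N
    have "green x N z \<le> 1 * ennreal (1 / (1 - u))"
      by (rule order_trans[OF green_le]) (intro mult_mono bound, auto simp: hit_prob_def Z.emeasure_le_1)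
    then have "ennreal (\<Sum>n\<le>N. measure (srw E z) {\<omega>. \<omega> n = x}) \<le> ennreal (1 / (1 - u))"
      by (simp add: green_def Z.emeasure_eq_measure sum_ennreal)
    then show "(\<Sum>n\<le>N. measure (srw E z) {\<omega>. \<omega> n = x}) \<le> 1 / (1 - u)"
      using u by (simp add: ennreal_le_iff)
  qed simp
  then have "AE \<omega> in srw E z. eventually (\<lambda>n. \<omega> \<in> space (srw E z) - {\<omega>. \<omega> n = x}) sequentially"
    by (intro borel_cantelli_AE1) (auto simp: sets_srw visit_sets less_top[symmetric])
  then show ?thesis
  proof eventually_elim
    case (elim \<omega>)
    then obtain N where "\<forall>n\<ge>N. \<omega> n \<noteq> x" by (auto simp: eventually_sequentially)
    then have "{n. \<omega> n = x} \<subseteq> {..<N}" by (auto simp: not_le[symmetric])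
    then show ?case by (rule finite_subset) simp
  qed
qed

text \<open>The hypothesis says that \<open>g\<close> is an eigenfunction of the transition operator
  with eigenvalue \<open>\<rho>\<close>; each step of the walk contributes one factor.\<close>

lemma nn_integral_srw_power:
  fixes g :: "'v \<Rightarrow> ennreal"
  assumes "\<And>x. (\<Sum>y\<in>nbrs E x. g y) / of_nat deg = \<rho> * g x"
  shows "(\<integral>\<^sup>+ \<omega>. g (\<omega> n) \<partial>srw E x) = \<rho> ^ n * g x"
proof (induction n arbitrary: x)
  case 0
  have "(\<integral>\<^sup>+ \<omega>. g (\<omega> 0) \<partial>srw E x) = (\<integral>\<^sup>+ \<omega>. g x \<partial>srw E x)"
    by (rule nn_integral_cong_AE) (use srw_start[of x] in eventually_elim, simp)
  then show ?case by (simp add: prob_space.emeasure_space_1[OF prob_space_srw, simplified])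
next
  case (Suc n)
  have [measurable]: "(\<lambda>\<omega>. g (\<omega> n)) \<in> borel_measurable path_space" for n :: nat
    by (rule measurable_compose[OF path_evaluation_measurable]) simp
  have "(\<integral>\<^sup>+ \<omega>. g (\<omega> (Suc n)) \<partial>srw E x) = (\<Sum>y\<in>nbrs E x. \<rho> ^ n * g y) / of_nat deg"
    by (subst nn_integral_srw_first_step) (simp_all add: Suc)
  also have "\<dots> = \<rho> ^ n * ((\<Sum>y\<in>nbrs E x. g y) / of_nat deg)"
    unfolding sum_distrib_left[symmetric] divide_ennreal_def by (simp only: mult_ac)
  finally show ?case by (simp add: assms mult_ac)
qed


section \<open>The two-sided walk started from counting measure\<close>

definition two_sided :: "'v \<Rightarrow> (int \<Rightarrow> 'v) measure" where
  "two_sided x = distr (srw E x \<Otimes>\<^sub>M srw E x) path_space glue_paths"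

text \<open>
  The law of the two-sided walk started from counting measure, which is invariant under time shifts
  because the walk is reversible.
\<close>

definition walk_measure :: "(int \<Rightarrow> 'v) measure" where
  "walk_measure = count_space UNIV \<bind> two_sided"

lemma measurable_glue_paths: "glue_paths \<in> measurable (srw E x \<Otimes>\<^sub>M srw E x) path_space"
proof (rule measurable_PiM_single')
  show "(\<lambda>p. glue_paths p i) \<in> measurable (srw E x \<Otimes>\<^sub>M srw E x) (count_space UNIV)" for i
    unfolding glue_paths_def by measurable
qed auto

lemma sets_two_sided [measurable_cong]: "sets (two_sided x) = sets path_space"
  by (simp add: two_sided_def)

lemma prob_space_two_sided: "prob_space (two_sided x)"
  unfolding two_sided_def
  by (intro prob_space.prob_space_distr prob_space_pair prob_space_srw measurable_glue_paths)

lemma measurable_two_sided: "two_sided \<in> measurable (count_space UNIV) (subprob_algebra path_space)"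
  by (simp add: measurable_def space_subprob_algebra sets_two_sided prob_space_imp_subprob_space
    prob_space_two_sided)

lemma sets_walk_measure [measurable_cong]: "sets walk_measure = sets path_space"
  unfolding walk_measure_def by (rule sets_bind) (auto simp: sets_two_sided)

lemma space_walk_measure [simp]: "space walk_measure = UNIV"
  using sets_eq_imp_space_eq[OF sets_walk_measure] by (simp add: space_PiM)

lemma space_two_sided [simp]: "space (two_sided x) = UNIV"
  using sets_eq_imp_space_eq[OF sets_two_sided] by (simp add: space_PiM)

lemma emeasure_walk_measure:
  "A \<in> sets path_space \<Longrightarrow> emeasure walk_measure A = (\<integral>\<^sup>+ x. emeasure (two_sided x) A \<partial>count_space UNIV)"
  unfolding walk_measure_def by (rule emeasure_bind[OF _ measurable_two_sided]) auto

text \<open>Independence of the two halves gives one product for each. Symmetry of the steps lets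
  the backward product be read forwards in time, so both merge into one product over the whole
  window.\<close>

lemma emeasure_two_sided_cylinder:
  "emeasure (two_sided x) {w. \<forall>i\<in>{- int k..int l}. w i = a i} =
    indicator {a 0} x * (\<Prod>i\<in>{- int k..<int l}. ennreal (pmf (step_law E (a i)) (a (i + 1))))"
proof -
  let ?t = "\<lambda>x y. ennreal (pmf (step_law E x) y)"
  let ?F = "{\<omega>. \<forall>i\<in>{..l}. \<omega> i = a (int i)}" and ?B = "{\<omega>. \<forall>i\<in>{..k}. \<omega> i = a (- int i)}"
  interpret X: prob_space "srw E x" by (rule prob_space_srw)
  interpret P: pair_prob_space "srw E x" "srw E x" ..
  \<comment> \<open>Gluing reads position 0 from the forward half only. The prescribed value at time
    0 therefore constrains the backward half only when both halves start at the same vertex, which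
    holds almost surely.\<close>
  have "(\<forall>i\<in>{- int k..int l}. glue_paths p i = a i) \<longleftrightarrow> p \<in> ?F \<times> ?B" if "fst p 0 = snd p 0" for p
  proof
    assume *: "\<forall>i\<in>{- int k..int l}. glue_paths p i = a i"
    have "fst p i = a (int i)" if "i \<le> l" for i
      using *[rule_format, of "int i"] that by (simp add: glue_paths_def)
    moreover have "snd p i = a (- int i)" if "i \<le> k" for i
      using *[rule_format, of "- int i"] that \<open>fst p 0 = snd p 0\<close>
      by (cases "i = 0") (auto simp: glue_paths_def)
    ultimately show "p \<in> ?F \<times> ?B" by (cases p) auto
  next
    assume *: "p \<in> ?F \<times> ?B"
    show "\<forall>i\<in>{- int k..int l}. glue_paths p i = a i"
    proof
      fix i assume i: "i \<in> {- int k..int l}"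
      show "glue_paths p i = a i"
      proof (cases "i \<ge> 0")
        case True
        then have "nat i \<in> {..l}" using i by auto
        then show ?thesis using * True by (auto simp: glue_paths_def)
      next
        case False
        then have "nat (- i) \<in> {..k}" using i by auto
        then show ?thesis using * False by (auto simp: glue_paths_def)
      qed
    qed
  qed
  then have iff: "glue_paths p \<in> {w. \<forall>i\<in>{- int k..int l}. w i = a i} \<longleftrightarrow> p \<in> ?F \<times> ?B"
    if "fst p 0 = x" "snd p 0 = x" for p using that by simp
  have "emeasure (two_sided x) {w. \<forall>i\<in>{- int k..int l}. w i = a i}
      = emeasure (srw E x \<Otimes>\<^sub>M srw E x) (glue_paths -` {w. \<forall>i\<in>{- int k..int l}. w i = a i})"
    unfolding two_sided_def
    by (subst emeasure_distr) (auto simp: measurable_glue_paths cylinder_in_sets space_pair_measure)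
  also have "\<dots> = emeasure (srw E x \<Otimes>\<^sub>M srw E x) (?F \<times> ?B)"
  proof (rule emeasure_eq_AE)
    have "AE p in srw E x \<Otimes>\<^sub>M srw E x. fst p 0 = x \<and> snd p 0 = x"
    proof (rule P.AE_pair_measure)
      show "AE \<omega> in srw E x. AE \<omega>' in srw E x. fst (\<omega>, \<omega>') 0 = x \<and> snd (\<omega>, \<omega>') 0 = x"
        using srw_start[of x] by auto
    qed measurable
    then show "AE p in srw E x \<Otimes>\<^sub>M srw E x. p \<in> glue_paths -` {w. \<forall>i\<in>{- int k..int l}. w i = a i} \<longleftrightarrow> p \<in> ?F \<times> ?B"
      by eventually_elim (unfold vimage_eq, rule iff, auto)
    show "glue_paths -` {w. \<forall>i\<in>{- int k..int l}. w i = a i} \<in> sets (srw E x \<Otimes>\<^sub>M srw E x)"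
      using measurable_sets[OF measurable_glue_paths cylinder_in_sets[of "{- int k..int l}" a], of x]
      by (simp add: space_pair_measure)
    show "?F \<times> ?B \<in> sets (srw E x \<Otimes>\<^sub>M srw E x)"
      by (intro pair_measureI) (simp_all only: sets_srw cylinder_in_sets finite_atMost)
  qed
  also have "\<dots> = emeasure (srw E x) ?F * emeasure (srw E x) ?B"
    by (rule X.emeasure_pair_measure_Times) (simp_all only: sets_srw cylinder_in_sets finite_atMost)
  also have "\<dots> = indicator {a 0} x * ((\<Prod>i<k. ?t (a (- int i)) (a (- int (Suc i)))) * (\<Prod>i<l. ?t (a (int i)) (a (int (Suc i)))))"
    unfolding emeasure_srw_cylinder[where a="\<lambda>i. a (int i)"] emeasure_srw_cylinder[where a="\<lambda>i. a (- int i)"]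
    by (simp add: indicator_def ac_simps)
  \<comment> \<open>The reversal: the backward step from \<open>- i\<close> to
    \<open>- i - 1\<close> is indexed by its left end point.\<close>
  also have "(\<Prod>i<k. ?t (a (- int i)) (a (- int (Suc i)))) = (\<Prod>i\<in>{- int k..<0}. ?t (a i) (a (i + 1)))"
    by (rule prod.reindex_bij_witness[where i="\<lambda>i. nat (- i - 1)" and j="\<lambda>i. - int (Suc i)"])
       (auto simp: pmf_step_law_sym[of "a (- int i)" for i])
  also have "(\<Prod>i<l. ?t (a (int i)) (a (int (Suc i)))) = (\<Prod>i\<in>{0..<int l}. ?t (a i) (a (i + 1)))"
    by (rule prod.reindex_bij_witness[where i=nat and j=int]) (auto simp: add.commute)
  also have "(\<Prod>i\<in>{- int k..<0}. ?t (a i) (a (i + 1))) * (\<Prod>i\<in>{0..<int l}. ?t (a i) (a (i + 1)))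
     = (\<Prod>i\<in>{- int k..<0} \<union> {0..<int l}. ?t (a i) (a (i + 1)))"
    by (rule prod.union_disjoint[symmetric]) auto
  also have "{- int k..<0} \<union> {0..<int l} = {- int k..<int l}" by auto
  finally show ?thesis .
qed

text \<open>Summing over the start removes the indicator. What remains depends only on consecutive
  pairs of positions and no longer singles out time 0.\<close>

lemma emeasure_walk_measure_cylinder:
  "emeasure walk_measure {w. \<forall>i\<in>{- int k..int l}. w i = a i} =
    (\<Prod>i\<in>{- int k..<int l}. ennreal (pmf (step_law E (a i)) (a (i + 1))))"
proof -
  have "emeasure walk_measure {w. \<forall>i\<in>{- int k..int l}. w i = a i} =
     (\<integral>\<^sup>+ x. (\<Prod>i\<in>{- int k..<int l}. ennreal (pmf (step_law E (a i)) (a (i + 1)))) * indicator {a 0} x \<partial>count_space UNIV)"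
    by (simp add: emeasure_walk_measure cylinder_in_sets emeasure_two_sided_cylinder mult.commute
      del: nn_integral_indicator_singleton nn_integral_cmult_indicator)
  then show ?thesis by (simp add: one_ennreal_def[symmetric])
qed

lemma walk_measure_cylinder_finite: "emeasure walk_measure {w. \<forall>i\<in>{- int k..int l}. w i = a i} \<noteq> \<infinity>"
  unfolding emeasure_walk_measure_cylinder by (simp add: ennreal_prod_eq_top)

lemma measurable_time_shift: "(\<lambda>w n. w (n + k)) \<in> measurable path_space path_space" for k :: int
  by (rule measurable_PiM_single') auto

lemma measurable_vertex_map: "(\<lambda>w. \<phi> \<circ> w) \<in> measurable path_space path_space" for \<phi> :: "'v \<Rightarrow> 'v"
  by (rule measurable_PiM_single') (auto simp: comp_def intro: measurable_compose[OF path_evaluation_measurable])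

text \<open>The windows begin with radius 1. After a shift by one they still contain 0, as required
  by the form \<open>{- int k..int l}\<close> of the cylinder formula; radius 0 would be moved to
  \<open>{1..1}\<close>.\<close>

lemma walk_measure_eqI:
  assumes "sets N = sets path_space"
    and "\<And>n a. emeasure N {w. \<forall>i\<in>{- int (Suc n)..int (Suc n)}. w i = a i} =
      (\<Prod>i\<in>{- int (Suc n)..<int (Suc n)}. ennreal (pmf (step_law E (a i)) (a (i + 1))))"
  shows "N = walk_measure"
proof (rule sym, rule measure_eq_on_cylinders[where I="\<lambda>n. {- int (Suc n)..int (Suc n)}"])
  show "(\<Union>n. {- int (Suc n)..int (Suc n)}) = UNIV"
  proof (intro set_eqI iffI)
    fix i :: int
    have "i \<in> {- int (Suc (nat \<bar>i\<bar>))..int (Suc (nat \<bar>i\<bar>))}" by auto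
    then show "i \<in> (\<Union>n. {- int (Suc n)..int (Suc n)})" by blast
  qed simp
  show "incseq (\<lambda>n. {- int (Suc n)..int (Suc n)})" by (auto simp: incseq_def)
  show "emeasure walk_measure {w. \<forall>i\<in>{- int (Suc n)..int (Suc n)}. w i = a i} =
     emeasure N {w. \<forall>i\<in>{- int (Suc n)..int (Suc n)}. w i = a i}" for n a
    by (simp only: assms emeasure_walk_measure_cylinder)
  show "emeasure walk_measure {w. \<forall>i\<in>{- int (Suc 0)..int (Suc 0)}. w i = a i} \<noteq> \<infinity>" for a
    by (rule walk_measure_cylinder_finite)
qed (auto simp: countable_vertices assms sets_walk_measure)

lemma walk_measure_shift1: "distr walk_measure path_space (\<lambda>w n. w (n + 1)) = walk_measure"
proof (rule walk_measure_eqI)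
  fix n and a :: "int \<Rightarrow> 'v"
  let ?t = "\<lambda>x y. ennreal (pmf (step_law E x) y)"
  have "(\<lambda>w n. w (n + 1)) -` {w. \<forall>i\<in>{- int (Suc n)..int (Suc n)}. w i = a i}
     = {w. \<forall>i\<in>{- int n..int (Suc (Suc n))}. w i = a (i - 1)}"
  proof (intro set_eqI iffI; clarsimp)
    fix w i assume "\<forall>i\<in>{- 1 - int n..1 + int n}. w (i + 1) = a i" "- int n \<le> i" "i \<le> 2 + int n"
    from this(1)[rule_format, of "i - 1"] this(2,3) show "w i = a (i - 1)" by auto
  qed
  then have "emeasure (distr walk_measure path_space (\<lambda>w n. w (n + 1))) {w. \<forall>i\<in>{- int (Suc n)..int (Suc n)}. w i = a i}
    = emeasure walk_measure {w. \<forall>i\<in>{- int n..int (Suc (Suc n))}. w i = a (i - 1)}"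
    by (subst emeasure_distr)
       (simp_all only: cylinder_in_sets finite_atLeastAtMost_int measurable_time_shift space_walk_measure Int_UNIV_right
         measurable_cong_sets[OF sets_walk_measure refl])
  also have "\<dots> = (\<Prod>i\<in>{- int n..<int (Suc (Suc n))}. ?t (a (i - 1)) (a (i + 1 - 1)))"
    by (rule emeasure_walk_measure_cylinder)
  also have "\<dots> = (\<Prod>i\<in>{- int (Suc n)..<int (Suc n)}. ?t (a i) (a (i + 1)))"
    by (rule prod.reindex_bij_witness[where i="\<lambda>i. i + 1" and j="\<lambda>i. i - 1"]) auto
  finally show "emeasure (distr walk_measure path_space (\<lambda>w n. w (n + 1))) {w. \<forall>i\<in>{- int (Suc n)..int (Suc n)}. w i = a i} = \<dots>" .
qed simp

lemma walk_measure_shift: "distr walk_measure path_space (\<lambda>w n. w (n + k)) = walk_measure" for k :: int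
proof -
  have comp: "distr (distr walk_measure path_space (\<lambda>w n. w (n + i))) path_space (\<lambda>w n. w (n + j))
      = distr walk_measure path_space (\<lambda>w n. w (n + (j + i)))" for i j :: int
    by (subst distr_distr) (simp_all add: measurable_time_shift measurable_cong_sets[OF sets_walk_measure refl] comp_def add.assoc)
  have pos: "distr walk_measure path_space (\<lambda>w i. w (i + int n)) = walk_measure" for n
  proof (induction n)
    case 0
    show ?case by (simp add: distr_id2 sets_walk_measure)
  next
    case (Suc n)
    then show ?case using comp[of "int n" 1] by (simp add: walk_measure_shift1)
  qed
  show ?thesis
  proof (cases "k \<ge> 0")
    case True
    then show ?thesis using pos[of "nat k"] by simp
  next
    case False
    \<comment> \<open>A negative shift undoes a positive one, and the inner measure is already known
      to be \<open>walk_measure\<close>.\<close>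
    then have "distr (distr walk_measure path_space (\<lambda>w n. w (n + int (nat (- k))))) path_space (\<lambda>w n. w (n + k)) = walk_measure"
      by (subst comp) (simp add: distr_id2 sets_walk_measure)
    then show ?thesis by (simp only: pos)
  qed
qed

lemma walk_measure_aut:
  assumes \<phi>: "\<phi> \<in> \<Gamma>"
  shows "distr walk_measure path_space (\<lambda>w. \<phi> \<circ> w) = walk_measure"
proof (rule walk_measure_eqI)
  fix n and a :: "int \<Rightarrow> 'v"
  let ?t = "\<lambda>x y. ennreal (pmf (step_law E x) y)"
  have "(\<lambda>w. \<phi> \<circ> w) -` {w. \<forall>i\<in>{- int (Suc n)..int (Suc n)}. w i = a i}
     = {w. \<forall>i\<in>{- int (Suc n)..int (Suc n)}. w i = inv \<phi> (a i)}"
    using aut_bij[OF \<phi>] by (auto simp: bij_inv_eq_iff bij_is_inj)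
  then have "emeasure (distr walk_measure path_space (\<lambda>w. \<phi> \<circ> w)) {w. \<forall>i\<in>{- int (Suc n)..int (Suc n)}. w i = a i}
    = emeasure walk_measure {w. \<forall>i\<in>{- int (Suc n)..int (Suc n)}. w i = inv \<phi> (a i)}"
    by (subst emeasure_distr)
       (simp_all only: cylinder_in_sets finite_atLeastAtMost_int measurable_vertex_map space_walk_measure Int_UNIV_right
         measurable_cong_sets[OF sets_walk_measure refl])
  also have "\<dots> = (\<Prod>i\<in>{- int (Suc n)..<int (Suc n)}. ?t (inv \<phi> (a i)) (inv \<phi> (a (i + 1))))"
    by (rule emeasure_walk_measure_cylinder)
  also have "\<dots> = (\<Prod>i\<in>{- int (Suc n)..<int (Suc n)}. ?t (a i) (a (i + 1)))"
    by (simp only: pmf_step_law_aut[OF aut_inv[OF \<phi>]])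
  finally show "emeasure (distr walk_measure path_space (\<lambda>w. \<phi> \<circ> w)) {w. \<forall>i\<in>{- int (Suc n)..int (Suc n)}. w i = a i} = \<dots>" .
qed simp

end

section \<open>Trajectories modulo time shifts\<close>

abbreviation time_shift :: "int \<Rightarrow> (int \<Rightarrow> 'v) \<Rightarrow> int \<Rightarrow> 'v" where
  "time_shift k w \<equiv> (\<lambda>n. w (n + k))"

text \<open>A substitute for \<open>hit_time K w = n\<close> that is a countable condition on
  coordinates, hence measurable on the full path space, and that does not involve a minimum of a
  possibly infinite set.\<close>

definition enters :: "'v set \<Rightarrow> int \<Rightarrow> (int \<Rightarrow> 'v) \<Rightarrow> bool" where
  "enters K n w \<longleftrightarrow> w n \<in> K \<and> (\<forall>m<n. w m \<notin> K)"

lemma enters_time_shift: "enters K n (time_shift k w) \<longleftrightarrow> enters K (n + k) w"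
proof -
  have "(\<forall>m<n. w (m + k) \<notin> K) \<longleftrightarrow> (\<forall>m<n + k. w m \<notin> K)"
  proof (intro iffI allI impI)
    fix m assume *: "\<forall>m<n. w (m + k) \<notin> K" and "m < n + k"
    then have "m - k < n" by simp
    with * have "w (m - k + k) \<notin> K" by blast
    then show "w m \<notin> K" by simp
  qed simp
  then show ?thesis by (simp add: enters_def)
qed

lemma time_shift_in_trajs: "time_shift k w \<in> trajs E \<longleftrightarrow> w \<in> trajs E"
proof -
  have imp: "time_shift k w \<in> trajs E" if w: "w \<in> trajs E" for w :: "int \<Rightarrow> 'a" and k
  proof -
    have "{n. w (n + k) = x} = (\<lambda>n. n - k) ` {n. w n = x}" for x
      by (auto simp: image_iff) (metis add_diff_cancel_right')
    moreover have "{w (n + k), w (n + 1 + k)} \<in> E" for n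
      using w by (simp add: trajs_def add.assoc add.commute[of 1 k]) (simp add: add.assoc[symmetric])
    ultimately show ?thesis using w by (simp add: trajs_def)
  qed
  show ?thesis using imp[of w k] imp[of "time_shift k w" "- k"] by auto
qed

lemma trajs_visits_finite:
  assumes "w \<in> trajs E" "finite K" shows "finite {n. w n \<in> K}"
proof -
  have "{n. w n \<in> K} = (\<Union>x\<in>K. {n. w n = x})" by auto
  then show ?thesis using assms by (simp add: trajs_def)
qed

text \<open>Membership in \<open>trajs E\<close> and finiteness of \<open>K\<close> make the set of
  visit times finite, which is what gives \<open>Min\<close> its meaning.\<close>

lemma hit_time_eq_iff:
  assumes "w \<in> trajs E" "finite K"
  shows "(\<exists>n. w n \<in> K) \<and> hit_time K w = k \<longleftrightarrow> enters K k w"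
proof
  assume *: "(\<exists>n. w n \<in> K) \<and> hit_time K w = k"
  then have "k \<in> {n. w n \<in> K}" "\<forall>n\<in>{n. w n \<in> K}. k \<le> n"
    using trajs_visits_finite[OF assms] Min_in[of "{n. w n \<in> K}"] by (auto simp: hit_time_def)
  then show "enters K k w" by (force simp: enters_def)
next
  assume "enters K k w"
  then show "(\<exists>n. w n \<in> K) \<and> hit_time K w = k"
    unfolding hit_time_def enters_def
    by (intro conjI Min_eqI trajs_visits_finite[OF assms]) (auto simp: not_less[symmetric])
qed

text \<open>A trajectory that hits \<open>K\<close> has exactly one entry time, so the events of
  entering at time \<open>n\<close> partition the hitting event.\<close>

lemma sum_enters:
  assumes "w \<in> trajs E" "finite K"
  shows "(\<integral>\<^sup>+ n. of_bool (enters K n w) \<partial>count_space UNIV) = of_bool (\<exists>n. w n \<in> K)"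
proof (cases "\<exists>n. w n \<in> K")
  case True
  then have "of_bool (enters K n w) = (indicator {hit_time K w} n :: ennreal)" for n
    using hit_time_eq_iff[OF assms, of n] by (auto simp: indicator_def)
  then have "(\<integral>\<^sup>+ n. of_bool (enters K n w) \<partial>count_space UNIV) = (\<integral>\<^sup>+ n. indicator {hit_time K w} n \<partial>count_space UNIV)"
    by (intro nn_integral_cong)
  then show ?thesis using True by (simp add: one_ennreal_def[symmetric])
next
  case False
  then show ?thesis by (simp add: enters_def)
qed

lemma shift_rel_iff:
  "(w, w') \<in> shift_rel E \<longleftrightarrow> w \<in> trajs E \<and> (\<exists>k. w' = time_shift k w)"
proof
  assume "(w, w') \<in> shift_rel E"
  then obtain k where w: "w \<in> trajs E" and k: "\<And>n. w n = w' (n + k)"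
    unfolding shift_rel_def by blast
  have "w' = time_shift (- k) w" by (simp add: k)
  with w show "w \<in> trajs E \<and> (\<exists>k. w' = time_shift k w)" by (intro conjI exI)
next
  assume "w \<in> trajs E \<and> (\<exists>k. w' = time_shift k w)"
  then obtain k where w: "w \<in> trajs E" "w' = time_shift k w" by (elim conjE exE)
  then have "w' \<in> trajs E" by (simp only: time_shift_in_trajs)
  moreover have "\<forall>n. w n = w' (n + - k)" using w by simp
  ultimately show "(w, w') \<in> shift_rel E"
    unfolding shift_rel_def using w(1) by (intro CollectI case_prodI conjI exI)
qed

lemma equiv_shift_rel: "equiv (trajs E) (shift_rel E)"
proof (rule equivI)
  show "shift_rel E \<subseteq> trajs E \<times> trajs E" by (auto simp: shift_rel_def)
  show "refl_on (trajs E) (shift_rel E)"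
    by (auto simp: refl_on_def shift_rel_iff intro: exI[of _ 0])
  show "sym (shift_rel E)"
  proof (rule symI)
    fix v w assume "(v, w) \<in> shift_rel E"
    then obtain k where "v \<in> trajs E" "w = time_shift k v" by (auto simp: shift_rel_iff)
    then have "w \<in> trajs E" "v = time_shift (- k) w" by (simp_all add: time_shift_in_trajs)
    then show "(w, v) \<in> shift_rel E" unfolding shift_rel_iff by (intro conjI exI)
  qed
  show "trans (shift_rel E)"
  proof (rule transI)
    fix u v w assume "(u, v) \<in> shift_rel E" "(v, w) \<in> shift_rel E"
    then obtain k l where "u \<in> trajs E" "v = time_shift k u" "w = time_shift l v" by (auto simp: shift_rel_iff)
    then have "u \<in> trajs E" "w = time_shift (l + k) u" by (simp_all add: add.assoc)
    then show "(u, w) \<in> shift_rel E" unfolding shift_rel_iff by (intro conjI exI)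
  qed
qed

lemma proj_star_time_shift: "w \<in> trajs E \<Longrightarrow> proj_star E (time_shift k w) = proj_star E w"
  unfolding proj_star_def
  by (rule equiv_class_eq[OF equiv_shift_rel, symmetric]) (auto simp: shift_rel_iff)

lemma preimage_star_subset: "preimage_star E A \<subseteq> trajs E"
  by (auto simp: preimage_star_def)

lemma time_shift_in_preimage_star: "time_shift k w \<in> preimage_star E A \<longleftrightarrow> w \<in> preimage_star E A"
  by (auto simp: preimage_star_def time_shift_in_trajs proj_star_time_shift)

lemma preimage_star_Int: "preimage_star E (A \<inter> B) = preimage_star E A \<inter> preimage_star E B"
  by (auto simp: preimage_star_def)

lemma preimage_star_hitting: "preimage_star E (trajs_star_hitting E K) = {w \<in> trajs E. \<exists>n. w n \<in> K}"
proof (intro set_eqI iffI)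
  fix w assume "w \<in> preimage_star E (trajs_star_hitting E K)"
  then obtain v n where w: "w \<in> trajs E" and v: "v \<in> trajs E" "v n \<in> K" "proj_star E w = proj_star E v"
    by (auto simp: preimage_star_def trajs_star_hitting_def)
  from v have "(v, w) \<in> shift_rel E"
    unfolding proj_star_def using w eq_equiv_class[OF _ equiv_shift_rel, of E v w] by auto
  then obtain k where "w = time_shift k v" by (auto simp: shift_rel_iff)
  then have "w (n - k) \<in> K" using v by simp
  then show "w \<in> {w \<in> trajs E. \<exists>n. w n \<in> K}" using w by blast
qed (auto simp: preimage_star_def trajs_star_hitting_def)

lemma proj_star_in_trajs_star: "w \<in> trajs E \<Longrightarrow> proj_star E w \<in> trajs_star E"
  by (auto simp: trajs_star_def proj_star_def quotientI)

lemma preimage_trajs_star: "preimage_star E (trajs_star E) = trajs E"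
  by (auto simp: preimage_star_def proj_star_in_trajs_star)

lemma trajs_star_hitting_subset: "trajs_star_hitting E K \<subseteq> trajs_star E"
  by (auto simp: trajs_star_hitting_def proj_star_in_trajs_star)

context transitive_network
begin

lemma comp_in_trajs:
  assumes "\<phi> \<in> \<Gamma>" shows "\<phi> \<circ> w \<in> trajs E \<longleftrightarrow> w \<in> trajs E"
proof -
  have "\<phi> (w n) = x \<longleftrightarrow> w n = inv \<phi> x" for n x
    using aut_bij[OF assms] by (metis bij_inv_eq_iff)
  moreover have "(\<forall>x. finite {n. w n = inv \<phi> x}) \<longleftrightarrow> (\<forall>x. finite {n. w n = x})"
    by (metis aut_inv_apply(1)[OF assms])
  ultimately show ?thesis by (simp add: trajs_def aut_edge[OF assms])
qed

section \<open>Measurability on path space\<close>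

lemma pred_path_space_iff: "Measurable.pred path_space P \<longleftrightarrow> {w. P w} \<in> sets path_space"
  by (simp add: pred_def space_PiM)

lemma pred_all_vertices:
  assumes "\<And>x :: 'v. Measurable.pred M (P x)"
  shows "Measurable.pred M (\<lambda>w. \<forall>x. P x w)"
proof -
  have "{w \<in> space M. \<forall>x. P x w} = (\<Inter>x. {w \<in> space M. P x w})" by auto
  also have "\<dots> \<in> sets M"
    using assms countable_vertices by (intro sets.countable_INT') (auto simp: pred_def)
  finally show ?thesis by (simp add: pred_def)
qed

lemma path_pred [measurable]: "Measurable.pred path_space (\<lambda>w. w n \<in> A)"
  by (rule measurable_compose[OF path_evaluation_measurable]) simp

lemma edge_pred [measurable]: "Measurable.pred path_space (\<lambda>w. {w m, w n} \<in> E)"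
proof -
  \<comment> \<open>A relation between two coordinates is expressed by events about single
    coordinates, at the price of a quantifier over the countable vertex set.\<close>
  have "Measurable.pred path_space (\<lambda>w. \<forall>x. w m \<in> {x} \<longrightarrow> w n \<in> nbrs E x)"
    by (intro pred_all_vertices pred_intros_logic path_pred)
  then show ?thesis by (simp add: nbrs_def)
qed

lemma enters_pred [measurable]: "Measurable.pred path_space (enters K n)"
  unfolding enters_def[abs_def] by measurable

lemma trajs_in_sets: "trajs E \<in> sets path_space"
proof -
  \<comment> \<open>A set of integers is finite exactly when it is bounded, and boundedness needs
    only countable quantifiers.\<close>
  have fin: "finite {n. w n = x} \<longleftrightarrow> (\<exists>N. \<forall>n. \<bar>n\<bar> > int N \<longrightarrow> w n \<notin> {x})" for w :: "int \<Rightarrow> 'v" and x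
  proof
    assume "finite {n. w n = x}"
    then have "finite ((\<lambda>n. nat \<bar>n\<bar>) ` {n. w n = x})" by simp
    then obtain N where "\<forall>m\<in>(\<lambda>n. nat \<bar>n\<bar>) ` {n. w n = x}. m \<le> N"
      using finite_nat_set_iff_bounded_le by blast
    then have "\<forall>n. \<bar>n\<bar> > int N \<longrightarrow> w n \<notin> {x}" by force
    then show "\<exists>N. \<forall>n. \<bar>n\<bar> > int N \<longrightarrow> w n \<notin> {x}" ..
  next
    assume "\<exists>N. \<forall>n. \<bar>n\<bar> > int N \<longrightarrow> w n \<notin> {x}"
    then obtain N where "\<forall>n. \<bar>n\<bar> > int N \<longrightarrow> w n \<notin> {x}" ..
    then have "{n. w n = x} \<subseteq> {- int N..int N}" by force
    then show "finite {n. w n = x}" by (rule finite_subset) simp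
  qed
  have "Measurable.pred path_space (\<lambda>w. \<forall>x. \<exists>N. \<forall>n. \<bar>n\<bar> > int N \<longrightarrow> w n \<notin> {x :: 'v})"
    by (intro pred_all_vertices) measurable
  then have "Measurable.pred path_space (\<lambda>w. (\<forall>n. {w n, w (n + 1)} \<in> E) \<and> (\<forall>x. \<exists>N. \<forall>n. \<bar>n\<bar> > int N \<longrightarrow> w n \<notin> {x}))"
    by measurable
  then show ?thesis
    unfolding pred_path_space_iff trajs_def fin .
qed

lemma sets_traj_space_iff: "A \<in> sets (traj_space E) \<longleftrightarrow> A \<in> sets path_space \<and> A \<subseteq> trajs E"
  unfolding sets_traj_space_eq_restrict_space
  by (subst sets_restrict_space_iff) (auto simp: trajs_in_sets space_PiM)

lemma trajs_star_in_sets_star: "trajs_star E \<in> sets_star E"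
  by (simp add: sets_star_def preimage_trajs_star sets_traj_space_iff trajs_in_sets)

lemma hitting_in_sets: "{w \<in> trajs E. \<exists>n. w n \<in> K} \<in> sets path_space"
proof -
  have "{w :: int \<Rightarrow> 'v. \<exists>n. w n \<in> K} \<in> sets path_space"
    unfolding pred_path_space_iff[symmetric] by measurable
  moreover have "{w \<in> trajs E. \<exists>n. w n \<in> K} = trajs E \<inter> {w. \<exists>n. w n \<in> K}" by auto
  ultimately show ?thesis using trajs_in_sets by simp
qed

lemma trajs_star_hitting_in_sets_star: "trajs_star_hitting E K \<in> sets_star E"
  using trajs_star_hitting_subset
  by (auto simp: sets_star_def preimage_star_hitting sets_traj_space_iff hitting_in_sets)

lemma enters_in_sets: "B \<in> sets path_space \<Longrightarrow> {w \<in> B. enters K n w} \<in> sets path_space"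
  using sets.Int[of B path_space, OF _ enters_pred[of K n, unfolded pred_path_space_iff]] by (simp add: Int_def)

text \<open>Mass transport over the time axis: every trajectory in \<open>B\<close> that hits \<open>K\<close> sends all its mass to
  its shift that enters \<open>K\<close> at time 0.\<close>

lemma nn_integral_walk_measure_hitting:
  fixes F :: "(int \<Rightarrow> 'v) \<Rightarrow> ennreal"
  assumes K: "finite K" and B: "B \<in> sets path_space" "B \<subseteq> trajs E"
    and shift: "\<And>w k. time_shift k w \<in> B \<longleftrightarrow> w \<in> B"
    and F: "F \<in> borel_measurable path_space"
  shows "(\<integral>\<^sup>+ w. F w * indicator {w \<in> B. \<exists>n. w n \<in> K} w \<partial>walk_measure) =
    (\<integral>\<^sup>+ w. (\<integral>\<^sup>+ n. F (time_shift n w) \<partial>count_space UNIV) * indicator {w \<in> B. enters K 0 w} w \<partial>walk_measure)"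
proof -
  note cong = measurable_cong_sets[OF sets_walk_measure refl]
  have meas: "(\<lambda>w. F w * indicator {w \<in> B. enters K n w} w) \<in> borel_measurable path_space" for n
    by (intro borel_measurable_times_ennreal F borel_measurable_indicator enters_in_sets B)
  have meas': "(\<lambda>w. F (time_shift n w) * indicator {w \<in> B. enters K 0 w} w) \<in> borel_measurable path_space" for n
    by (intro borel_measurable_times_ennreal measurable_compose[OF measurable_time_shift F] borel_measurable_indicator enters_in_sets B)
  have ind: "indicator {w \<in> B. enters K n w} (time_shift (- n) w) = (indicator {w \<in> B. enters K 0 w} w :: ennreal)" for n w
    unfolding indicator_def mem_Collect_eq shift enters_time_shift by simp
  have "(\<integral>\<^sup>+ w. F w * indicator {w \<in> B. \<exists>n. w n \<in> K} w \<partial>walk_measure)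
     = (\<integral>\<^sup>+ w. (\<integral>\<^sup>+ n. F w * indicator {w \<in> B. enters K n w} w \<partial>count_space UNIV) \<partial>walk_measure)"
  proof (rule nn_integral_cong)
    fix w :: "int \<Rightarrow> 'v"
    show "F w * indicator {w \<in> B. \<exists>n. w n \<in> K} w = (\<integral>\<^sup>+ n. F w * indicator {w \<in> B. enters K n w} w \<partial>count_space UNIV)"
    proof (cases "w \<in> B")
      case True
      then have "(\<integral>\<^sup>+ n. indicator {w \<in> B. enters K n w} w \<partial>count_space UNIV) = of_bool (\<exists>n. w n \<in> K)"
        using sum_enters[OF subsetD[OF B(2) True] K] by (simp add: indicator_def)
      then show ?thesis using True by (simp add: nn_integral_cmult indicator_def)
    qed simp
  qed
  also have "\<dots> = (\<integral>\<^sup>+ n. (\<integral>\<^sup>+ w. F w * indicator {w \<in> B. enters K n w} w \<partial>walk_measure) \<partial>count_space UNIV)"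
    by (rule nn_integral_count_space_nn_integral) (auto simp: cong meas)
  also have "\<dots> = (\<integral>\<^sup>+ n. (\<integral>\<^sup>+ w. F (time_shift (- n) w) * indicator {w \<in> B. enters K 0 w} w \<partial>walk_measure) \<partial>count_space UNIV)"
  proof (rule nn_integral_cong)
    \<comment> \<open>Invariance of \<open>walk_measure\<close> moves the entry time from
      \<open>n\<close> to 0; afterwards \<open>n\<close> occurs only inside \<open>F\<close>, so the
      sum over time acts on \<open>F\<close> alone.\<close>
    fix n :: int
    have "(\<integral>\<^sup>+ w. F w * indicator {w \<in> B. enters K n w} w \<partial>walk_measure)
       = (\<integral>\<^sup>+ w. F w * indicator {w \<in> B. enters K n w} w \<partial>distr walk_measure path_space (time_shift (- n)))"
      by (simp only: walk_measure_shift)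
    also have "\<dots> = (\<integral>\<^sup>+ w. F (time_shift (- n) w) * indicator {w \<in> B. enters K n w} (time_shift (- n) w) \<partial>walk_measure)"
      by (rule nn_integral_distr) (simp_all only: cong measurable_distr_eq1 measurable_time_shift meas)
    finally show "(\<integral>\<^sup>+ w. F w * indicator {w \<in> B. enters K n w} w \<partial>walk_measure)
       = (\<integral>\<^sup>+ w. F (time_shift (- n) w) * indicator {w \<in> B. enters K 0 w} w \<partial>walk_measure)"
      by (simp only: ind)
  qed
  also have "\<dots> = (\<integral>\<^sup>+ n. (\<integral>\<^sup>+ w. F (time_shift n w) * indicator {w \<in> B. enters K 0 w} w \<partial>walk_measure) \<partial>count_space UNIV)"
    by (rule nn_integral_bij_count_space[where g=uminus])
      (auto intro!: bij_betw_byWitness[where f'=uminus])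
  also have "\<dots> = (\<integral>\<^sup>+ w. (\<integral>\<^sup>+ n. F (time_shift n w) * indicator {w \<in> B. enters K 0 w} w \<partial>count_space UNIV) \<partial>walk_measure)"
    by (rule nn_integral_count_space_nn_integral[symmetric]) (auto simp: cong meas')
  also have "\<dots> = (\<integral>\<^sup>+ w. (\<integral>\<^sup>+ n. F (time_shift n w) \<partial>count_space UNIV) * indicator {w \<in> B. enters K 0 w} w \<partial>walk_measure)"
    by (simp add: nn_integral_multc)
  finally show ?thesis .
qed

lemma two_sided_start: "AE w in two_sided x. w 0 = x"
proof -
  have "emeasure (two_sided x) {w. w 0 = x} = 1"
    using emeasure_two_sided_cylinder[where k=0 and l=0 and a="\<lambda>_. x"] by simp
  moreover have "Measurable.pred (two_sided x) (\<lambda>w. w 0 \<in> {x})"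
    by (simp only: measurable_cong_sets[OF sets_two_sided refl] path_pred)
  ultimately show ?thesis
    using prob_space.AE_iff_emeasure_eq_1[OF prob_space_two_sided, where P="\<lambda>w. w 0 \<in> {x}"] by simp
qed

text \<open>Identifies the measures that define the intensity with one fixed shift-invariant
  measure, restricted to paths whose entry time is 0.\<close>

lemma Q_measure_eq:
  assumes K: "finite K" and B: "B \<in> sets path_space" "B \<subseteq> trajs E"
  shows "Q_measure E K B = emeasure walk_measure {w \<in> B. enters K 0 w}"
proof -
  have eq: "{w \<in> B. (\<exists>n. w n \<in> K) \<and> hit_time K w = 0} = {w \<in> B. enters K 0 w}"
    using hit_time_eq_iff[of _ E K 0] K B by blast
  have "biinf_srw E x = restrict_space (two_sided x) (trajs E)" for x
    by (simp add: biinf_srw_def two_sided_def)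
  then have "emeasure (biinf_srw E x) {w \<in> B. enters K 0 w} = emeasure (two_sided x) {w \<in> B. enters K 0 w}" for x
    using B trajs_in_sets by (simp only:) (subst emeasure_restrict_space, auto simp: sets_two_sided)
  then have "Q_measure E K B = (\<Sum>x\<in>K. emeasure (two_sided x) {w \<in> B. enters K 0 w})"
    by (simp add: Q_measure_def eq)
  also have "\<dots> = (\<integral>\<^sup>+ x. emeasure (two_sided x) {w \<in> B. enters K 0 w} \<partial>count_space UNIV)"
  proof (rule nn_integral_count_space'[symmetric])
    \<comment> \<open>Entering at time 0 forces the start into \<open>K\<close>, so the finite sum
      may be extended to all vertices.\<close>
    fix x assume "x \<notin> K"
    from two_sided_start[of x] have "AE w in two_sided x. \<not> (w \<in> B \<and> enters K 0 w)"
      by eventually_elim (use \<open>x \<notin> K\<close> in \<open>auto simp: enters_def\<close>)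
    then show "emeasure (two_sided x) {w \<in> B. enters K 0 w} = 0"
      using emeasure_eq_0_AE[where P="\<lambda>w. w \<in> B \<and> enters K 0 w" and M="two_sided x"] by simp
  qed (use K in auto)
  also have "\<dots> = emeasure walk_measure {w \<in> B. enters K 0 w}"
    by (simp add: emeasure_walk_measure enters_in_sets B)
  finally show ?thesis .
qed

section \<open>Almost every two-sided path is a trajectory\<close>

lemma AE_srw_first_step:
  assumes "Measurable.pred path_space P" and "\<And>y. y \<in> nbrs E x \<Longrightarrow> AE \<omega> in srw E y. P (case_nat x \<omega>)"
  shows "AE \<omega> in srw E x. P \<omega>"
proof -
  have [measurable]: "Measurable.pred path_space P" by fact
  have sets: "{\<omega>. \<not> P \<omega>} \<in> sets path_space"
    unfolding pred_path_space_iff[symmetric] by measurable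
  have "emeasure (srw E y) {\<omega>. \<not> P (case_nat x \<omega>)} = 0" if "y \<in> nbrs E x" for y
    using emeasure_eq_0_AE[where P="\<lambda>\<omega>. \<not> P (case_nat x \<omega>)" and M="srw E y"] assms(2)[OF that] by simp
  then have "emeasure (srw E x) {\<omega>. \<not> P \<omega>} = 0"
    by (simp add: emeasure_srw_first_step[OF sets])
  then show ?thesis
    by (subst AE_iff_measurable[OF _ refl]) (auto simp: sets sets_srw)
qed

lemma srw_edges: "AE \<omega> in srw E x. \<forall>n. {\<omega> n, \<omega> (Suc n)} \<in> E"
proof -
  have "AE \<omega> in srw E x. {\<omega> n, \<omega> (Suc n)} \<in> E" for n
  proof (induction n arbitrary: x)
    case 0
    show ?case
    proof (rule AE_srw_first_step)
      fix y assume "y \<in> nbrs E x"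
      with srw_start[of y] show "AE \<omega> in srw E y. {case_nat x \<omega> 0, case_nat x \<omega> (Suc 0)} \<in> E"
        by (auto elim!: eventually_mono simp: nbrs_def)
    qed (rule edge_pred)
  next
    case (Suc n)
    show ?case by (rule AE_srw_first_step[OF edge_pred]) (simp add: Suc)
  qed
  then show ?thesis by (simp add: AE_all_countable)
qed

lemma glue_paths_in_trajs:
  assumes p: "fst p 0 = snd p 0"
    and edges: "\<And>n. {fst p n, fst p (Suc n)} \<in> E" "\<And>n. {snd p n, snd p (Suc n)} \<in> E"
    and fin: "\<And>x. finite {n. fst p n = x}" "\<And>x. finite {n. snd p n = x}"
  shows "glue_paths p \<in> trajs E"
  unfolding trajs_def
proof (intro CollectI conjI allI)
  fix n :: int
  show "{glue_paths p n, glue_paths p (n + 1)} \<in> E"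
  proof (cases "n \<ge> 0")
    case True
    then show ?thesis using edges(1)[of "nat n"] by (simp add: glue_paths_def nat_add_distrib)
  next
    case False
    \<comment> \<open>The step from \<open>n\<close> to \<open>n + 1\<close> is the backward step
      \<open>m\<close>, traversed in reverse. For \<open>m = 0\<close> its end is read from the
      forward half, and the common start \<open>p\<close> is used.\<close>
    define m where "m = nat (- n - 1)"
    have n: "n = - 1 - int m" using False by (simp add: m_def)
    show ?thesis
      using edges(2)[of m] p unfolding n
      by (cases m) (auto simp: glue_paths_def insert_commute nat_add_distrib Suc_nat_eq_nat_zadd1 add.commute nat_diff_distrib)
  qed
next
  fix x
  have "{n. glue_paths p n = x} \<subseteq> int ` {n. fst p n = x} \<union> (\<lambda>n. - int n) ` {n. snd p n = x}"
  proof
    fix n assume n: "n \<in> {n. glue_paths p n = x}"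
    show "n \<in> int ` {n. fst p n = x} \<union> (\<lambda>n. - int n) ` {n. snd p n = x}"
    proof (cases "n \<ge> 0")
      case True
      then have "n = int (nat n)" "nat n \<in> {n. fst p n = x}" using n by (auto simp: glue_paths_def)
      then show ?thesis by blast
    next
      case False
      then have "n = - int (nat (- n))" "nat (- n) \<in> {n. snd p n = x}" using n by (auto simp: glue_paths_def)
      then show ?thesis by blast
    qed
  qed
  then show "finite {n. glue_paths p n = x}"
    by (rule finite_subset) (simp add: fin)
qed

text \<open>Reduces an almost sure statement about two-sided paths to a one-sided property required
  of each half separately.\<close>

lemma AE_two_sidedI:
  assumes P: "Measurable.pred path_space P"
    and ae: "\<And>\<omega> \<omega>'. good \<omega> \<Longrightarrow> good \<omega>' \<Longrightarrow> P (glue_paths (\<omega>, \<omega>'))"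
    and good: "AE \<omega> in srw E x. good \<omega>"
  shows "AE w in two_sided x. P w"
proof -
  interpret X: prob_space "srw E x" by (rule prob_space_srw)
  interpret XX: pair_prob_space "srw E x" "srw E x" ..
  have [measurable]: "Measurable.pred path_space P" by fact
  note [measurable] = measurable_glue_paths[of x]
  have "AE p in srw E x \<Otimes>\<^sub>M srw E x. P (glue_paths p)"
  proof (rule XX.AE_pair_measure)
    show "AE \<omega> in srw E x. AE \<omega>' in srw E x. P (glue_paths (\<omega>, \<omega>'))"
      using good by eventually_elim (use good in eventually_elim, simp add: ae)
  qed measurable
  then show ?thesis
    unfolding two_sided_def
    by (subst AE_distr_iff) (auto simp: measurable_glue_paths intro: predE[OF P])
qed

lemma AE_two_sided_trajs: "AE w in two_sided x. w \<in> trajs E"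
proof (rule AE_two_sidedI)
  let ?good = "\<lambda>\<omega>. \<omega> 0 = x \<and> (\<forall>n. {\<omega> n, \<omega> (Suc n)} \<in> E) \<and> (\<forall>y\<in>UNIV. finite {n. \<omega> n = y})"
  show "Measurable.pred path_space (\<lambda>w. w \<in> trajs E)"
    using trajs_in_sets by (simp add: pred_path_space_iff)
  have "AE \<omega> in srw E x. \<forall>y\<in>UNIV. finite {n. \<omega> n = y}"
    by (subst AE_ball_countable[OF countable_vertices]) (simp add: AE_finite_visits)
  with srw_start[of x] srw_edges[of x] show "AE \<omega> in srw E x. ?good \<omega>"
    by eventually_elim simp
  show "glue_paths (\<omega>, \<omega>') \<in> trajs E" if "?good \<omega>" "?good \<omega>'" for \<omega> \<omega>'
    using that by (intro glue_paths_in_trajs) auto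
qed

lemma AE_walk_measureI:
  assumes P: "Measurable.pred path_space P" and ae: "\<And>x. AE w in two_sided x. P w"
  shows "AE w in walk_measure. P w"
  unfolding walk_measure_def by (subst AE_bind[OF measurable_two_sided P]) (simp add: ae)

end

text \<open>Finitely many vertices with finitely many visits each cannot fill all integer times.
  This is the source of the infinite incoming mass in the unimodular case.\<close>

lemma infinite_range_traj:
  assumes "w \<in> trajs E" shows "infinite (range w)"
proof
  assume "finite (range w)"
  then have "finite (\<Union>x\<in>range w. {n. w n = x})"
    by (rule finite_UN_I) (use assms in \<open>simp add: trajs_def\<close>)
  moreover have "(\<Union>x\<in>range w. {n. w n = x}) = UNIV" by auto
  ultimately show False using infinite_UNIV_int by simp
qed

context transitive_network
begin

section \<open>No invariant lift on unimodular graphs\<close>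

lemma preimage_star_in_sets: "A \<in> sets_star E \<Longrightarrow> preimage_star E A \<in> sets path_space"
  by (simp add: sets_star_def sets_traj_space_iff)

lemma emeasure_walk_measure_start: "emeasure walk_measure {w. w 0 = x} = 1"
  using emeasure_walk_measure_cylinder[where k=0 and l=0 and a="\<lambda>_. x"] by simp

lemma emeasure_intensity_hitting:
  assumes "is_interlacement_intensity E \<nu>" "A \<in> sets_star E" "finite K"
  shows "emeasure \<nu> (A \<inter> trajs_star_hitting E K) = emeasure walk_measure {w \<in> preimage_star E A. enters K 0 w}"
  using assms
  by (simp add: is_interlacement_intensity_def Q_measure_eq preimage_star_in_sets preimage_star_subset)

text \<open>If the intensity vanished, entering a vertex at time 0 would be null, and by shifting so
  would hitting it at any time; but the walk started there alone contributes mass 1.\<close>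

lemma intensity_nonzero:
  assumes \<nu>: "is_interlacement_intensity E \<nu>"
  shows "emeasure \<nu> (trajs_star E) \<noteq> 0"
proof
  assume zero: "emeasure \<nu> (trajs_star E) = 0"
  fix x :: 'v
  have sets_\<nu>: "sets \<nu> = sets_star E" using \<nu> by (simp add: is_interlacement_intensity_def)
  have "emeasure \<nu> (trajs_star E \<inter> trajs_star_hitting E {x}) \<le> emeasure \<nu> (trajs_star E)"
    by (intro emeasure_mono) (auto simp: sets_\<nu> trajs_star_in_sets_star)
  then have null: "emeasure walk_measure {w \<in> trajs E. enters {x} 0 w} = 0"
    using zero emeasure_intensity_hitting[OF \<nu> trajs_star_in_sets_star, of "{x}"]
    by (simp add: preimage_trajs_star)
  have "emeasure walk_measure {w \<in> trajs E. \<exists>n. w n \<in> {x}}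
      = (\<integral>\<^sup>+ w. (\<integral>\<^sup>+ n. 1 \<partial>count_space (UNIV :: int set)) * indicator {w \<in> trajs E. enters {x} 0 w} w \<partial>walk_measure)"
    using nn_integral_walk_measure_hitting[of "{x}" "trajs E" "\<lambda>_. 1"] trajs_in_sets hitting_in_sets[of "{x}"]
    by (simp add: time_shift_in_trajs sets_walk_measure)
  \<comment> \<open>The inner integral counts all integers and is infinite; it is multiplied by a
    null event, and infinity times 0 is 0 in \<open>ennreal\<close>.\<close>
  also have "\<dots> = 0"
    using null enters_in_sets[OF trajs_in_sets, of "{x}" 0]
    by (subst nn_integral_cmult_indicator) (simp_all add: sets_walk_measure)
  finally have "emeasure walk_measure {w \<in> trajs E. \<exists>n. w n \<in> {x}} = 0" .
  moreover have "emeasure (two_sided x) {w \<in> trajs E. \<exists>n. w n \<in> {x}} \<le> emeasure walk_measure {w \<in> trajs E. \<exists>n. w n \<in> {x}}"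
    unfolding emeasure_walk_measure[OF hitting_in_sets] by (rule nn_integral_ge_point) simp
  moreover have "emeasure (two_sided x) {w \<in> trajs E. \<exists>n. w n \<in> {x}} = 1"
  proof (rule prob_space.emeasure_eq_1_AE[OF prob_space_two_sided])
    show "AE w in two_sided x. w \<in> {w \<in> trajs E. \<exists>n. w n \<in> {x}}"
      using two_sided_start[of x] AE_two_sided_trajs[of x] by eventually_elim auto
  qed (simp only: sets_two_sided hitting_in_sets)
  ultimately show False by simp
qed

text \<open>The intensity of trajectories through \<open>x\<close> is the mass of paths that are at
  \<open>x\<close> for the first time at time 0, which is at most the mass 1 of all paths from
  \<open>x\<close>.\<close>

lemma emeasure_intensity_hitting_finite:
  assumes \<nu>: "is_interlacement_intensity E \<nu>"
  shows "emeasure \<nu> (trajs_star_hitting E {x}) < \<infinity>"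
proof -
  have "emeasure \<nu> (trajs_star E \<inter> trajs_star_hitting E {x}) = emeasure walk_measure {w \<in> trajs E. enters {x} 0 w}"
    using emeasure_intensity_hitting[OF \<nu> trajs_star_in_sets_star, of "{x}"] by (simp add: preimage_trajs_star)
  also have "\<dots> \<le> emeasure walk_measure {w. w 0 = x}"
    using cylinder_in_sets[of "{0::int}" "\<lambda>_. x"]
    by (intro emeasure_mono) (auto simp: sets_walk_measure enters_def)
  also have "\<dots> < \<infinity>" by (simp add: emeasure_walk_measure_start)
  finally show ?thesis by (simp add: Int_absorb1[OF trajs_star_hitting_subset] Int_commute)
qed

lemma no_invariant_lift_if_unimodular:
  assumes \<nu>: "is_interlacement_intensity E \<nu>" and unimod: "unimodular_graph E"
    and space_Q: "space Q = trajs E" and sets_Q: "sets Q = sets (traj_space E)"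
    and lift: "\<And>A. A \<in> sets_star E \<Longrightarrow> emeasure \<nu> A = emeasure Q (preimage_star E A)"
    and inv: "\<And>B \<phi>. B \<in> sets (traj_space E) \<Longrightarrow> \<phi> \<in> \<Gamma> \<Longrightarrow> emeasure Q B = emeasure Q ((\<lambda>w. \<phi> \<circ> w) ` B)"
  shows False
proof -
  define H where "H x = {w \<in> trajs E. \<exists>n. w n \<in> {x}}" for x
  define D where "D y = {w \<in> trajs E. w 0 = y}" for y
  define f where "f x y = measure Q (H x \<inter> D y)" for x y
  have H_sets: "H x \<in> sets Q" for x
    unfolding H_def sets_Q sets_traj_space_iff by (intro conjI hitting_in_sets) blast
  have D_sets: "D y \<in> sets Q" for y
  proof -
    have "D y = trajs E \<inter> {w. \<forall>i\<in>{0}. w i = y}" by (auto simp: D_def)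
    then show ?thesis
      using trajs_in_sets cylinder_in_sets[of "{0::int}" "\<lambda>_. y"] by (simp add: sets_Q sets_traj_space_iff)
  qed
  have H_finite: "emeasure Q (H x) < \<infinity>" for x
    using lift[OF trajs_star_hitting_in_sets_star[of "{x}"]] emeasure_intensity_hitting_finite[OF \<nu>, of x]
    by (simp add: preimage_star_hitting H_def)
  \<comment> \<open>Mass transports are real-valued, so finiteness of \<open>Q\<close> on
    \<open>H x\<close> is what makes \<open>f\<close> record the true masses.\<close>
  have f: "ennreal (f x y) = emeasure Q (H x \<inter> D y)" for x y
  proof -
    have "emeasure Q (H x \<inter> D y) \<le> emeasure Q (H x)" by (intro emeasure_mono H_sets) auto
    then have "emeasure Q (H x \<inter> D y) \<noteq> \<infinity>" using H_finite[of x] by (auto simp: top_unique)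
    then show ?thesis by (simp add: f_def emeasure_eq_ennreal_measure)
  qed
  have image: "(\<lambda>w. \<phi> \<circ> w) ` (H x \<inter> D y) = H (\<phi> x) \<inter> D (\<phi> y)" if \<phi>: "\<phi> \<in> \<Gamma>" for \<phi> x y
  proof (intro set_eqI iffI)
    fix w assume "w \<in> H (\<phi> x) \<inter> D (\<phi> y)"
    then have "w = \<phi> \<circ> (inv \<phi> \<circ> w)" "inv \<phi> \<circ> w \<in> H x \<inter> D y"
      using comp_in_trajs[OF aut_inv[OF \<phi>], of w]
      by (auto simp: H_def D_def fun_eq_iff aut_inv_apply[OF \<phi>]) (metis aut_inv_apply(1)[OF \<phi>])
    then show "w \<in> (\<lambda>w. \<phi> \<circ> w) ` (H x \<inter> D y)" by blast
  next
    fix w assume "w \<in> (\<lambda>w. \<phi> \<circ> w) ` (H x \<inter> D y)"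
    then show "w \<in> H (\<phi> x) \<inter> D (\<phi> y)"
      using comp_in_trajs[OF \<phi>] by (auto simp: H_def D_def)
  qed
  have "mass_transport E f"
    unfolding mass_transport_def
  proof (intro conjI allI ballI)
    fix x y \<phi> assume \<phi>: "\<phi> \<in> \<Gamma>"
    have "H x \<inter> D y \<in> sets (traj_space E)" using H_sets D_sets sets_Q by auto
    from inv[OF this \<phi>] show "f x y = f (\<phi> x) (\<phi> y)"
      by (simp add: f_def measure_def image[OF \<phi>])
  qed (simp add: f_def)
  then have mtp: "(\<integral>\<^sup>+ x. ennreal (f v x) \<partial>count_space UNIV) = (\<integral>\<^sup>+ x. ennreal (f x v) \<partial>count_space UNIV)" for v
    using unimod by (auto simp: unimodular_graph_def)
  have "emeasure Q (D y) = 0" for y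
  proof -
    \<comment> \<open>The outgoing mass of \<open>y\<close>: trajectories through \<open>y\<close>
      are sorted by their position at time 0.\<close>
    have "emeasure Q (H y) = (\<integral>\<^sup>+ x. emeasure Q (H y \<inter> D x) \<partial>count_space UNIV)"
    proof -
      have "H y = (\<Union>x. H y \<inter> D x)" by (auto simp: H_def D_def)
      then show ?thesis
        using emeasure_UN_countable[of UNIV "\<lambda>x. H y \<inter> D x" Q] H_sets D_sets countable_vertices
        by (simp add: disjoint_family_on_def D_def) blast
    qed
    also have "\<dots> = (\<integral>\<^sup>+ x. emeasure Q (H x \<inter> D y) \<partial>count_space UNIV)"
      using mtp[of y] by (simp add: f)
    also have "\<dots> = (\<integral>\<^sup>+ x. (\<integral>\<^sup>+ w. indicator (H x \<inter> D y) w \<partial>Q) \<partial>count_space UNIV)"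
      using H_sets D_sets by simp
    also have "\<dots> = (\<integral>\<^sup>+ w. (\<integral>\<^sup>+ x. indicator (H x \<inter> D y) w \<partial>count_space UNIV) \<partial>Q)"
      by (rule nn_integral_count_space_nn_integral[symmetric]) (use countable_vertices H_sets D_sets in auto)
    also have "\<dots> = (\<integral>\<^sup>+ w. \<infinity> * indicator (D y) w \<partial>Q)"
    proof (rule nn_integral_cong)
      fix w
      show "(\<integral>\<^sup>+ x. indicator (H x \<inter> D y) w \<partial>count_space UNIV) = \<infinity> * indicator (D y) w"
      proof (cases "w \<in> D y")
        \<comment> \<open>A trajectory that is at \<open>y\<close> at time 0 is counted once for
          every vertex it visits.\<close>
        case True
        then have "(\<integral>\<^sup>+ x. indicator (H x \<inter> D y) w \<partial>count_space UNIV) = (\<integral>\<^sup>+ x. indicator (range w) x \<partial>count_space UNIV)"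
          by (intro nn_integral_cong) (auto simp: H_def D_def indicator_def)
        also have "\<dots> = \<infinity>" using True infinite_range_traj[of w E] by (simp add: D_def)
        finally show ?thesis using True by simp
      qed simp
    qed
    also have "\<dots> = \<infinity> * emeasure Q (D y)" using D_sets by (rule nn_integral_cmult_indicator)
    \<comment> \<open>A finite mass equals infinity times \<open>emeasure Q (D y)\<close>, so the
      latter is 0. The countably many sets \<open>D y\<close> cover all trajectories, hence
      \<open>Q\<close> vanishes, and so does the intensity.\<close>
    finally show ?thesis using H_finite[of y] by (auto simp: ennreal_top_mult split: if_splits)
  qed
  then have "(\<Union>y. D y) \<in> null_sets Q"
    by (intro null_sets_UN') (auto simp: countable_vertices D_sets)
  moreover have "(\<Union>y. D y) = trajs E" by (auto simp: D_def)
  ultimately have "emeasure Q (trajs E) = 0" by auto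
  then show False
    using intensity_nonzero[OF \<nu>] lift[OF trajs_star_in_sets_star] by (simp add: preimage_trajs_star)
qed


section \<open>The modular cocycle\<close>

definition stab_orbit :: "'v \<Rightarrow> 'v \<Rightarrow> 'v set" where
  "stab_orbit x y = {\<phi> y | \<phi>. \<phi> \<in> \<Gamma> \<and> \<phi> x = x}"

text \<open>Its cardinality is the index of the stabilizer of \<open>x\<close>, \<open>y\<close>,
  \<open>z\<close> in that of \<open>x\<close>, \<open>y\<close>. These indices are the auxiliary
  factors that cancel in the cocycle identity.\<close>

definition stab2_orbit :: "'v \<Rightarrow> 'v \<Rightarrow> 'v \<Rightarrow> 'v set" where
  "stab2_orbit x y z = {\<phi> z | \<phi>. \<phi> \<in> \<Gamma> \<and> \<phi> x = x \<and> \<phi> y = y}"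

text \<open>Both cardinalities are indices of the common stabilizer of \<open>x\<close> and
  \<open>y\<close>, in the stabilizers of \<open>x\<close> and of \<open>y\<close> respectively.
  Their quotient is thus the Haar measure of the first stabilizer over that of the second.\<close>

definition modular :: "'v \<Rightarrow> 'v \<Rightarrow> real" where
  "modular x y = real (card (stab_orbit x y)) / real (card (stab_orbit y x))"

lemma stab2_orbit_commute: "stab2_orbit x y z = stab2_orbit y x z"
  by (auto simp: stab2_orbit_def)

lemma stab_orbit_refl: "y \<in> stab_orbit x y"
  using aut_id by (auto simp: stab_orbit_def intro!: exI[of _ id])

text \<open>Automorphisms preserve the length of edge paths, so an orbit fixing \<open>x\<close>
  stays among the vertices reachable from \<open>x\<close> in a fixed number of steps.\<close>

lemma finite_stab_orbit: "finite (stab_orbit x y)"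
proof -
  let ?R = "{(u, v). {u, v} \<in> E}"
  obtain n where n: "(x, y) \<in> ?R ^^ n"
    using connected[of x y] by (auto simp: rtrancl_power)
  have step: "(\<phi> u, \<phi> v) \<in> ?R ^^ n" if "(u, v) \<in> ?R ^^ n" "\<phi> \<in> \<Gamma>" for u v \<phi> n
    using that by (induction n arbitrary: v) (auto simp: relcomp_unfold, metis aut_edge)
  have "stab_orbit x y \<subseteq> {z. (x, z) \<in> ?R ^^ n}"
  proof
    fix z assume "z \<in> stab_orbit x y"
    then obtain \<phi> where "\<phi> \<in> \<Gamma>" "\<phi> x = x" "z = \<phi> y" by (auto simp: stab_orbit_def)
    then show "z \<in> {z. (x, z) \<in> ?R ^^ n}" using step[OF n, of \<phi>] by simp
  qed
  then show ?thesis by (rule finite_subset) (rule finite_reachable)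
qed

lemma card_stab_orbit_pos: "card (stab_orbit x y) > 0"
  using stab_orbit_refl[of y x] finite_stab_orbit[of x y] by (auto simp: card_gt_0_iff)

lemma modular_pos: "modular x y > 0"
  by (simp add: modular_def card_stab_orbit_pos)

text \<open>Multiplicativity of indices along a chain of stabilizers. The pairs are fibred over the
  images \<open>y'\<close> of \<open>y\<close>, and an automorphism taking \<open>y\<close> to
  \<open>y'\<close> translates the fibre over \<open>y\<close> onto the one over
  \<open>y'\<close>.\<close>

lemma card_stab_orbit_mult:
  "card (stab_orbit x y) * card (stab2_orbit x y z) = card {(\<phi> y, \<phi> z) | \<phi>. \<phi> \<in> \<Gamma> \<and> \<phi> x = x}"
    (is "_ = card ?P")
proof -
  have P: "?P = (SIGMA y':stab_orbit x y. {z'. (y', z') \<in> ?P})"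
    by (auto simp: stab_orbit_def)
  have fin: "finite {z'. (y', z') \<in> ?P}" for y'
    by (rule finite_subset[OF _ finite_stab_orbit[of x z]]) (auto simp: stab_orbit_def)
  have "card {z'. (y', z') \<in> ?P} = card (stab2_orbit x y z)" if y': "y' \<in> stab_orbit x y" for y'
  proof -
    obtain \<psi> where \<psi>: "\<psi> \<in> \<Gamma>" "\<psi> x = x" "\<psi> y = y'" using y' by (auto simp: stab_orbit_def)
    have "{z'. (y', z') \<in> ?P} = \<psi> ` stab2_orbit x y z"
    proof (intro set_eqI iffI)
      fix z' assume "z' \<in> {z'. (y', z') \<in> ?P}"
      then obtain \<phi> where \<phi>: "\<phi> \<in> \<Gamma>" "\<phi> x = x" "\<phi> y = y'" "\<phi> z = z'" by auto
      have "inv \<psi> \<circ> \<phi> \<in> \<Gamma>" "(inv \<psi> \<circ> \<phi>) x = x" "(inv \<psi> \<circ> \<phi>) y = y"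
        using \<phi> \<psi> aut_inv_apply(1)[OF \<psi>(1), of x] aut_inv_apply(1)[OF \<psi>(1), of y]
        by (auto intro: aut_comp aut_inv)
      then have "(inv \<psi> \<circ> \<phi>) z \<in> stab2_orbit x y z" unfolding stab2_orbit_def by blast
      moreover have "z' = \<psi> ((inv \<psi> \<circ> \<phi>) z)" using \<phi> \<psi> by (simp add: aut_inv_apply)
      ultimately show "z' \<in> \<psi> ` stab2_orbit x y z" by blast
    next
      fix z' assume "z' \<in> \<psi> ` stab2_orbit x y z"
      then obtain \<phi> where \<phi>: "\<phi> \<in> \<Gamma>" "\<phi> x = x" "\<phi> y = y" "z' = \<psi> (\<phi> z)" by (auto simp: stab2_orbit_def)
      then have "\<psi> \<circ> \<phi> \<in> \<Gamma>" "(\<psi> \<circ> \<phi>) x = x" "(\<psi> \<circ> \<phi>) y = y'" "(\<psi> \<circ> \<phi>) z = z'"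
        using \<psi> by (auto intro: aut_comp)
      then show "z' \<in> {z'. (y', z') \<in> ?P}"
        by (intro CollectI exI[of _ "\<psi> \<circ> \<phi>"]) simp_all
    qed
    then show ?thesis
      by (simp add: card_image inj_on_def aut_eq_iff[OF \<psi>(1)])
  qed
  then show ?thesis
    by (subst P, subst card_SigmaI) (use fin in \<open>auto simp: finite_stab_orbit\<close>)
qed

lemma stab2_orbit_pos: "card (stab2_orbit x y z) > 0"
proof -
  have "z \<in> stab2_orbit x y z" using aut_id by (auto simp: stab2_orbit_def intro!: exI[of _ id])
  moreover have "stab2_orbit x y z \<subseteq> stab_orbit x z" by (auto simp: stab2_orbit_def stab_orbit_def)
  ultimately show ?thesis using finite_subset[OF _ finite_stab_orbit] by (auto simp: card_gt_0_iff)
qed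

lemma card_stab_orbit_swap:
  "card (stab_orbit x y) * card (stab2_orbit x y z) = card (stab_orbit x z) * card (stab2_orbit x z y)"
proof -
  have "{(\<phi> y, \<phi> z) | \<phi>. \<phi> \<in> \<Gamma> \<and> \<phi> x = x} = prod.swap ` {(\<phi> z, \<phi> y) | \<phi>. \<phi> \<in> \<Gamma> \<and> \<phi> x = x}"
    by force
  then show ?thesis
    unfolding card_stab_orbit_mult by (simp add: card_image)
qed

text \<open>Counting orbits of pairs from each of the three vertices in two orders gives three
  identities. Multiplying them leaves the claim times the triple indices \<open>p\<close>,
  \<open>q\<close>, \<open>r\<close>, which are positive and cancel.\<close>

lemma modular_cocycle: "modular x y * modular y z = modular x z"
proof -
  define a a' b b' c c' where "a = real (card (stab_orbit x y))" "a' = real (card (stab_orbit y x))"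
    "b = real (card (stab_orbit y z))" "b' = real (card (stab_orbit z y))"
    "c = real (card (stab_orbit x z))" "c' = real (card (stab_orbit z x))"
  note defs = this
  define p q r where "p = real (card (stab2_orbit x y z))" "q = real (card (stab2_orbit y z x))"
    "r = real (card (stab2_orbit x z y))"
  note defs = defs this
  have 1: "a * p = c * r"
    using card_stab_orbit_swap[of x y z] unfolding defs by (simp only: of_nat_mult[symmetric])
  have 2: "b * q = a' * p"
    using card_stab_orbit_swap[of y z x] unfolding defs stab2_orbit_commute[of y x] by (simp only: of_nat_mult[symmetric])
  have 3: "b' * q = c' * r"
    using card_stab_orbit_swap[of z y x] unfolding defs stab2_orbit_commute[of z y] stab2_orbit_commute[of z x]
    by (simp only: of_nat_mult[symmetric])
  have pos: "a > 0" "a' > 0" "b > 0" "b' > 0" "c > 0" "c' > 0" "p > 0" "q > 0" "r > 0"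
    unfolding defs by (simp_all add: card_stab_orbit_pos stab2_orbit_pos)
  have "(a * b * c') * (p * q * r) = (a * p) * (b * q) * (c' * r)" by (simp only: mult_ac)
  also have "\<dots> = (c * r) * (a' * p) * (b' * q)" by (simp only: 1 2 3)
  also have "\<dots> = (c * a' * b') * (p * q * r)" by (simp only: mult_ac)
  finally have "a * b * c' = c * a' * b'" using pos by simp
  then show ?thesis
    using pos unfolding modular_def defs[symmetric] by (simp add: field_simps)
qed

lemma modular_refl: "modular x x = 1"
  using card_stab_orbit_pos[of x x] by (simp add: modular_def)

lemma stab_orbit_aut: "\<phi> \<in> \<Gamma> \<Longrightarrow> stab_orbit (\<phi> x) (\<phi> y) = \<phi> ` stab_orbit x y"
proof (intro set_eqI iffI)
  fix z assume \<phi>: "\<phi> \<in> \<Gamma>" and "z \<in> stab_orbit (\<phi> x) (\<phi> y)"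
  then obtain \<psi> where \<psi>: "\<psi> \<in> \<Gamma>" "\<psi> (\<phi> x) = \<phi> x" "z = \<psi> (\<phi> y)" by (auto simp: stab_orbit_def)
  have "inv \<phi> \<circ> \<psi> \<circ> \<phi> \<in> \<Gamma>" "(inv \<phi> \<circ> \<psi> \<circ> \<phi>) x = x"
    using \<phi> \<psi> by (auto intro: aut_comp aut_inv simp: aut_inv_apply)
  then have "(inv \<phi> \<circ> \<psi> \<circ> \<phi>) y \<in> stab_orbit x y" unfolding stab_orbit_def by blast
  moreover have "z = \<phi> ((inv \<phi> \<circ> \<psi> \<circ> \<phi>) y)" using \<phi> \<psi> by (simp add: aut_inv_apply)
  ultimately show "z \<in> \<phi> ` stab_orbit x y" by blast
next
  fix z assume \<phi>: "\<phi> \<in> \<Gamma>" and "z \<in> \<phi> ` stab_orbit x y"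
  then obtain \<psi> where \<psi>: "\<psi> \<in> \<Gamma>" "\<psi> x = x" "z = \<phi> (\<psi> y)" by (auto simp: stab_orbit_def)
  have "\<phi> \<circ> \<psi> \<circ> inv \<phi> \<in> \<Gamma>" "(\<phi> \<circ> \<psi> \<circ> inv \<phi>) (\<phi> x) = \<phi> x" "(\<phi> \<circ> \<psi> \<circ> inv \<phi>) (\<phi> y) = z"
    using \<phi> \<psi> by (auto intro: aut_comp aut_inv simp: aut_inv_apply)
  then show "z \<in> stab_orbit (\<phi> x) (\<phi> y)" unfolding stab_orbit_def
    by (intro CollectI exI[of _ "\<phi> \<circ> \<psi> \<circ> inv \<phi>"]) simp_all
qed

lemma card_stab_orbit_aut: "\<phi> \<in> \<Gamma> \<Longrightarrow> card (stab_orbit (\<phi> x) (\<phi> y)) = card (stab_orbit x y)"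
  by (simp add: stab_orbit_aut card_image inj_on_def aut_eq_iff)

lemma modular_aut: "\<phi> \<in> \<Gamma> \<Longrightarrow> modular (\<phi> x) (\<phi> y) = modular x y"
  by (simp add: modular_def card_stab_orbit_aut)

section \<open>Modular correction of the mass transport principle\<close>

lemma nn_integral_of_bool_count_space:
  "finite {x. P x} \<Longrightarrow> (\<integral>\<^sup>+ x. of_bool (P x) \<partial>count_space UNIV) = of_nat (card {x. P x})"
proof -
  assume fin: "finite {x. P x}"
  have "(\<integral>\<^sup>+ x. of_bool (P x) \<partial>count_space UNIV) = (\<integral>\<^sup>+ x. indicator {x. P x} x \<partial>count_space UNIV)"
    by (intro nn_integral_cong) (auto simp: indicator_def)
  also have "\<dots> = of_nat (card {x. P x})" using fin by (simp add: emeasure_count_space)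
  finally show ?thesis .
qed

text \<open>The automorphisms taking \<open>y\<close> to \<open>v\<close> form a coset of the
  stabilizer of \<open>y\<close>, so the images of \<open>v\<close> under them are a translate of an
  orbit of that stabilizer.\<close>

lemma card_swapped_pairs:
  "card {\<phi> v | \<phi>. \<phi> \<in> \<Gamma> \<and> \<phi> y = v} = card (stab_orbit y v)"
  "finite {\<phi> v | \<phi>. \<phi> \<in> \<Gamma> \<and> \<phi> y = v}"
proof -
  obtain \<psi> where \<psi>: "\<psi> \<in> \<Gamma>" "\<psi> y = v" by (rule transitiveE)
  have eq: "{\<phi> v | \<phi>. \<phi> \<in> \<Gamma> \<and> \<phi> y = v} = \<psi> ` stab_orbit y v"
  proof (intro set_eqI iffI)
    fix z assume "z \<in> {\<phi> v | \<phi>. \<phi> \<in> \<Gamma> \<and> \<phi> y = v}"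
    then obtain \<phi> where \<phi>: "\<phi> \<in> \<Gamma>" "\<phi> y = v" "z = \<phi> v" by auto
    have "inv \<psi> \<circ> \<phi> \<in> \<Gamma>" "(inv \<psi> \<circ> \<phi>) y = y"
      using \<phi> \<psi> aut_inv_apply(1)[OF \<psi>(1), of y] by (auto intro: aut_comp aut_inv)
    then have "(inv \<psi> \<circ> \<phi>) v \<in> stab_orbit y v" unfolding stab_orbit_def by blast
    moreover have "z = \<psi> ((inv \<psi> \<circ> \<phi>) v)" using \<phi> \<psi> by (simp add: aut_inv_apply)
    ultimately show "z \<in> \<psi> ` stab_orbit y v" by blast
  next
    fix z assume "z \<in> \<psi> ` stab_orbit y v"
    then obtain \<phi> where \<phi>: "\<phi> \<in> \<Gamma>" "\<phi> y = y" "z = \<psi> (\<phi> v)" by (auto simp: stab_orbit_def)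
    then have "\<psi> \<circ> \<phi> \<in> \<Gamma>" "(\<psi> \<circ> \<phi>) y = v" "(\<psi> \<circ> \<phi>) v = z" using \<psi> by (auto intro: aut_comp)
    then show "z \<in> {\<phi> v | \<phi>. \<phi> \<in> \<Gamma> \<and> \<phi> y = v}"
      by (intro CollectI exI[of _ "\<psi> \<circ> \<phi>"]) simp_all
  qed
  show "card {\<phi> v | \<phi>. \<phi> \<in> \<Gamma> \<and> \<phi> y = v} = card (stab_orbit y v)"
    unfolding eq by (simp add: card_image inj_on_def aut_eq_iff[OF \<psi>(1)])
  show "finite {\<phi> v | \<phi>. \<phi> \<in> \<Gamma> \<and> \<phi> y = v}"
    unfolding eq by (simp add: finite_stab_orbit)
qed

text \<open>
  The mass transport principle with its modular correction, obtained by double counting the relation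
  ``\<open>(v, y)\<close> and \<open>(z, v)\<close> lie in the same orbit'' between \<open>y\<close> and \<open>z\<close>.
\<close>

lemma tilted_mass_transport:
  assumes f: "mass_transport E f"
  shows "(\<integral>\<^sup>+ y. ennreal (f v y) \<partial>count_space UNIV) =
    (\<integral>\<^sup>+ z. ennreal (f z v * modular z v) \<partial>count_space UNIV)"
proof -
  define R where "R y z \<longleftrightarrow> (\<exists>\<phi>\<in>\<Gamma>. \<phi> v = z \<and> \<phi> y = v)" for y z
  have nonneg: "f x y \<ge> 0" for x y using f by (simp add: mass_transport_def)
  have f_aut: "f (\<phi> x) (\<phi> y) = f x y" if "\<phi> \<in> \<Gamma>" for \<phi> x y
    using f that unfolding mass_transport_def by metis
  have Rset: "{z. R y z} = {\<phi> v | \<phi>. \<phi> \<in> \<Gamma> \<and> \<phi> y = v}" for y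
    by (auto simp: R_def)
  have Rset': "{y. R y z} = {\<phi> v | \<phi>. \<phi> \<in> \<Gamma> \<and> \<phi> z = v}" for z
  proof (intro set_eqI iffI)
    fix y assume "y \<in> {y. R y z}"
    then obtain \<phi> where \<phi>: "\<phi> \<in> \<Gamma>" "\<phi> v = z" "\<phi> y = v" by (auto simp: R_def)
    then have "inv \<phi> \<in> \<Gamma>" "inv \<phi> z = v" "inv \<phi> v = y"
      using aut_inv_apply(1)[OF \<phi>(1), of v] aut_inv_apply(1)[OF \<phi>(1), of y] by (auto intro: aut_inv)
    then show "y \<in> {\<phi> v | \<phi>. \<phi> \<in> \<Gamma> \<and> \<phi> z = v}" by force
  next
    fix y assume "y \<in> {\<phi> v | \<phi>. \<phi> \<in> \<Gamma> \<and> \<phi> z = v}"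
    then obtain \<phi> where \<phi>: "\<phi> \<in> \<Gamma>" "\<phi> z = v" "\<phi> v = y" by auto
    then have "inv \<phi> \<in> \<Gamma>" "inv \<phi> v = z" "inv \<phi> y = v"
      using aut_inv_apply(1)[OF \<phi>(1), of v] aut_inv_apply(1)[OF \<phi>(1), of z] by (auto intro: aut_inv)
    then show "y \<in> {y. R y z}" by (auto simp: R_def)
  qed
  have Rsum: "(\<integral>\<^sup>+ z. of_bool (R y z) \<partial>count_space UNIV) = of_nat (card (stab_orbit y v))"
    and Rsum': "(\<integral>\<^sup>+ z. of_bool (R z y) \<partial>count_space UNIV) = of_nat (card (stab_orbit y v))" for y
    by (simp_all add: nn_integral_of_bool_count_space Rset Rset' card_swapped_pairs)
  \<comment> \<open>On related pairs one automorphism carries \<open>(y, v)\<close> to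
    \<open>(v, z)\<close>, so both the transported mass and the normalizing cardinality agree.
    Summing over \<open>y\<close> then counts \<open>stab_orbit z v\<close>, and the quotient is
    \<open>modular z v\<close>.\<close>
  have R: "of_bool (R y z) * ennreal (f v y / card (stab_orbit y v)) = of_bool (R y z) * ennreal (f z v / card (stab_orbit v z))" for y z
  proof (cases "R y z")
    case True
    then obtain \<phi> where \<phi>: "\<phi> \<in> \<Gamma>" "\<phi> v = z" "\<phi> y = v" by (auto simp: R_def)
    show ?thesis using f_aut[OF \<phi>(1), of v y] card_stab_orbit_aut[OF \<phi>(1), of y v] \<phi> by simp
  qed simp
  have cancel: "of_nat (card (stab_orbit y v)) * ennreal (c / card (stab_orbit y v)) = ennreal c" if "c \<ge> 0" for y c
    using that card_stab_orbit_pos[of y v]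
    by (simp add: ennreal_of_nat_eq_real_of_nat ennreal_mult[symmetric])
  have "(\<integral>\<^sup>+ y. ennreal (f v y) \<partial>count_space UNIV)
      = (\<integral>\<^sup>+ y. (\<integral>\<^sup>+ z. of_bool (R y z) * ennreal (f v y / card (stab_orbit y v)) \<partial>count_space UNIV) \<partial>count_space UNIV)"
    by (intro nn_integral_cong) (simp add: nn_integral_multc Rsum cancel nonneg)
  also have "\<dots> = (\<integral>\<^sup>+ y. (\<integral>\<^sup>+ z. of_bool (R y z) * ennreal (f z v / card (stab_orbit v z)) \<partial>count_space UNIV) \<partial>count_space UNIV)"
    by (simp only: R)
  also have "\<dots> = (\<integral>\<^sup>+ z. (\<integral>\<^sup>+ y. of_bool (R y z) * ennreal (f z v / card (stab_orbit v z)) \<partial>count_space UNIV) \<partial>count_space UNIV)"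
    by (rule nn_integral_count_space_nn_integral) (auto simp: countable_vertices)
  also have "\<dots> = (\<integral>\<^sup>+ z. ennreal (f z v * modular z v) \<partial>count_space UNIV)"
    by (intro nn_integral_cong)
       (simp add: nn_integral_multc Rsum' modular_def ennreal_of_nat_eq_real_of_nat ennreal_mult[symmetric] nonneg mult.commute)
  finally show ?thesis .
qed

text \<open>Every vertex sends mass 1 to each neighbour. Together with the cocycle identity this is
  harmonicity of the modular weight.\<close>

lemma sum_modular_nbrs: "(\<Sum>y\<in>nbrs E v. modular y v) = real deg"
proof -
  define f where "f x y = (of_bool (y \<in> nbrs E x) :: real)" for x y
  have "mass_transport E f"
    by (auto simp: mass_transport_def f_def nbrs_def aut_edge)
  from tilted_mass_transport[OF this, of v]
  have "(\<integral>\<^sup>+ y. ennreal (f v y) \<partial>count_space UNIV) = (\<integral>\<^sup>+ z. ennreal (f z v * modular z v) \<partial>count_space UNIV)" .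
  moreover have "(\<integral>\<^sup>+ y. ennreal (f v y) \<partial>count_space UNIV) = (\<Sum>y\<in>nbrs E v. ennreal (f v y))"
    by (rule nn_integral_count_space') (auto simp: finite_nbrs f_def)
  moreover have "(\<integral>\<^sup>+ z. ennreal (f z v * modular z v) \<partial>count_space UNIV) = (\<Sum>z\<in>nbrs E v. ennreal (f z v * modular z v))"
    by (rule nn_integral_count_space'[OF finite_nbrs]) (auto simp: f_def nbrs_def insert_commute)
  moreover have "(\<Sum>z\<in>nbrs E v. ennreal (f z v * modular z v)) = (\<Sum>z\<in>nbrs E v. ennreal (modular z v))"
    by (intro sum.cong) (auto simp: f_def nbrs_def insert_commute)
  moreover have "(\<Sum>y\<in>nbrs E v. ennreal (f v y)) = ennreal (real deg)"
    by (simp add: f_def card_nbrs ennreal_of_nat_eq_real_of_nat)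
  moreover have "(\<Sum>z\<in>nbrs E v. ennreal (modular z v)) = ennreal (\<Sum>z\<in>nbrs E v. modular z v)"
    by (simp add: sum_ennreal modular_pos less_imp_le)
  ultimately have "ennreal (real deg) = ennreal (\<Sum>z\<in>nbrs E v. modular z v)" by simp
  then show ?thesis
    by (subst (asm) ennreal_inj) (auto intro!: sum_nonneg simp: modular_pos less_imp_le)
qed

text \<open>If the cocycle were 1 on every edge, it would be 1 along every path, and the corrected
  mass transport principle would be the plain one.\<close>

lemma modular_edge_nontrivial:
  assumes "\<not> unimodular_graph E"
  obtains x y where "y \<in> nbrs E x" "modular y x \<noteq> 1"
proof (rule ccontr)
  assume "\<not> thesis"
  then have "\<forall>x y. y \<in> nbrs E x \<longrightarrow> modular y x = 1" using that by blast
  then have edge: "modular y x = 1" if "{x, y} \<in> E" for x y using that by (simp add: nbrs_def)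
  have one: "modular y x = 1" for x y
  proof -
    from connected[of x y] show ?thesis
    proof (induction rule: rtrancl_induct)
      case base
      show ?case by (rule modular_refl)
    next
      case (step y z)
      then show ?case using modular_cocycle[of z y x] edge[of y z] by simp
    qed
  qed
  have "unimodular_graph E"
    unfolding unimodular_graph_def using tilted_mass_transport by (simp add: one)
  with assms show False ..
qed

end

section \<open>The invariant lift on non-unimodular graphs\<close>

lemma nn_integral_count_space_int:
  "(\<integral>\<^sup>+ n. F n \<partial>count_space UNIV) = (\<Sum>n. F (int_decode n))"
  unfolding nn_integral_count_space_nat[symmetric]
  by (rule nn_integral_bij_count_space[OF bij_int_decode, symmetric])

text \<open>Time 0 is counted in both halves, hence only an inequality; it suffices for
  finiteness.\<close>

lemma nn_integral_count_space_int_le: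
  fixes F :: "int \<Rightarrow> ennreal"
  shows "(\<integral>\<^sup>+ n. F n \<partial>count_space UNIV) \<le> (\<Sum>n. F (int n)) + (\<Sum>n. F (- int n))"
proof -
  have "(\<integral>\<^sup>+ n. F n \<partial>count_space UNIV)
    \<le> (\<integral>\<^sup>+ n. F n * indicator {0..} n + F n * indicator {..0} n \<partial>count_space UNIV)"
    by (intro nn_integral_mono) (auto simp: indicator_def)
  also have "\<dots> = (\<integral>\<^sup>+ n. F n \<partial>count_space {0..}) + (\<integral>\<^sup>+ n. F n \<partial>count_space {..0})"
    by (simp add: nn_integral_add nn_integral_count_space_indicator)
  also have "(\<integral>\<^sup>+ n. F n \<partial>count_space {0..}) = (\<integral>\<^sup>+ n. F (int n) \<partial>count_space UNIV)"
    by (rule nn_integral_bij_count_space[symmetric]) (rule bij_betw_byWitness[where f'=nat], simp_all add: image_subset_iff)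
  also have "(\<integral>\<^sup>+ n. F n \<partial>count_space {..0}) = (\<integral>\<^sup>+ n. F (- int n) \<partial>count_space UNIV)"
    by (rule nn_integral_bij_count_space[symmetric]) (rule bij_betw_byWitness[where f'="\<lambda>n. nat (- n)"], simp_all add: image_subset_iff)
  finally show ?thesis by (simp add: nn_integral_count_space_nat)
qed

lemma ennreal_divide_cancel_left:
  fixes a b c :: ennreal
  assumes "c \<noteq> 0" "c \<noteq> \<top>"
  shows "(c * a) / (c * b) = a / b"
proof -
  have "inverse (c * b) = inverse c * inverse b"
    using assms by (intro ennreal_inverse_mult') (auto simp: less_top[symmetric] zero_less_iff_neq_zero)
  moreover have "c * inverse c = 1"
    using assms ennreal_divide_self[of c] by (simp add: divide_ennreal_def less_top)
  ultimately have "(c * a) / (c * b) = (c * inverse c) * (a / b)"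
    by (simp only: divide_ennreal_def mult_ac)
  then show ?thesis by (simp add: \<open>c * inverse c = 1\<close>)
qed

context transitive_network
begin

text \<open>The eigenvalue \<open>\<rho>\<close> is the average of \<open>sqrt (modular y x)\<close>
  over the neighbours \<open>y\<close> of any vertex \<open>x\<close>. It is below 1 by comparison
  with the average of \<open>(1 + modular y x) / 2\<close>, which is 1 by
  \<open>sum_modular_nbrs\<close>.\<close>

lemma ex_contracting_weight:
  assumes "\<not> unimodular_graph E"
  obtains g :: "'v \<Rightarrow> ennreal" and \<rho> :: real where
    "\<And>x. g x \<noteq> 0" "\<And>x. g x \<noteq> \<infinity>" "0 \<le> \<rho>" "\<rho> < 1"
    "\<And>x. (\<Sum>y\<in>nbrs E x. g y) / of_nat deg = ennreal \<rho> * g x"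
    "\<And>\<phi>. \<phi> \<in> \<Gamma> \<Longrightarrow> \<exists>c. c \<noteq> 0 \<and> c \<noteq> \<infinity> \<and> (\<forall>x. g (\<phi> x) = c * g x)"
proof
  define s where "s x = (\<Sum>y\<in>nbrs E x. sqrt (modular y x))" for x
  fix o' :: 'v
  let ?g = "\<lambda>x. ennreal (sqrt (modular x o'))"
  \<comment> \<open>By transitivity a single edge with nontrivial cocycle gives the same strict
    contraction at every vertex.\<close>
  have s_const: "s x = s o'" for x
  proof -
    obtain \<phi> where \<phi>: "\<phi> \<in> \<Gamma>" "\<phi> o' = x" by (rule transitiveE)
    show ?thesis
      using sum_nbrs_aut[OF \<phi>(1), of "\<lambda>y. sqrt (modular y x)" o'] \<phi>(2) modular_aut[OF \<phi>(1), of _ o']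
      by (simp add: s_def)
  qed
  have le: "sqrt t \<le> (1 + t) / 2" if "t > 0" for t :: real
    using arith_geo_mean_sqrt[of 1 t] that by simp
  have less: "sqrt t < (1 + t) / 2" if "t > 0" "t \<noteq> 1" for t :: real
  proof -
    have "(sqrt t - 1)\<^sup>2 > 0" using that by simp
    then show ?thesis using that by (simp add: power2_diff)
  qed
  from modular_edge_nontrivial[OF assms] obtain a b where ab: "b \<in> nbrs E a" "modular b a \<noteq> 1" .
  have "s a < (\<Sum>y\<in>nbrs E a. (1 + modular y a) / 2)"
    unfolding s_def
  proof (rule sum_strict_mono_ex1)
    show "\<forall>y\<in>nbrs E a. sqrt (modular y a) \<le> (1 + modular y a) / 2"
      using le[OF modular_pos] by (rule ballI)
    show "\<exists>y\<in>nbrs E a. sqrt (modular y a) < (1 + modular y a) / 2"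
      by (rule bexI[of _ b], rule less[OF modular_pos ab(2)], rule ab(1))
  qed (rule finite_nbrs)
  also have "\<dots> = real deg"
    by (simp add: sum_divide_distrib[symmetric] sum.distrib sum_modular_nbrs card_nbrs)
  finally have s_less: "s o' < real deg" by (simp only: s_const[of a])
  have s_nonneg: "s o' \<ge> 0"
    unfolding s_def by (intro sum_nonneg) (simp add: modular_pos less_imp_le)
  show "?g x \<noteq> 0" "?g x \<noteq> \<infinity>" for x using modular_pos[of x o'] by simp_all
  show "0 \<le> s o' / real deg" "s o' / real deg < 1" using s_less s_nonneg deg_pos by simp_all
  show "(\<Sum>y\<in>nbrs E x. ?g y) / of_nat deg = ennreal (s o' / real deg) * ?g x" for x
  proof -
    have "(\<Sum>y\<in>nbrs E x. sqrt (modular y o')) = s x * sqrt (modular x o')"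
      unfolding s_def sum_distrib_right by (simp add: real_sqrt_mult[symmetric] modular_cocycle)
    then have "(\<Sum>y\<in>nbrs E x. ?g y) = ennreal (s o' * sqrt (modular x o'))"
      by (simp add: sum_ennreal modular_pos less_imp_le s_const[of x])
    then show ?thesis
      using s_nonneg deg_pos
      by (simp add: ennreal_of_nat_eq_real_of_nat divide_ennreal ennreal_mult[symmetric] modular_pos less_imp_le)
  qed
  show "\<exists>c. c \<noteq> 0 \<and> c \<noteq> \<infinity> \<and> (\<forall>x. ?g (\<phi> x) = c * ?g x)" if \<phi>: "\<phi> \<in> \<Gamma>" for \<phi>
  proof (intro exI conjI allI)
    \<comment> \<open>The constant is the weight of the image of the base point: the cocycle passes
      from \<open>\<phi> x\<close> through \<open>\<phi> o'\<close> to \<open>o'\<close>, and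
      invariance removes \<open>\<phi>\<close> from the first factor.\<close>
    show "?g (\<phi> x) = ?g (\<phi> o') * ?g x" for x
      using modular_cocycle[of "\<phi> x" "\<phi> o'" o'] modular_aut[OF \<phi>, of x o']
      by (simp add: ennreal_mult[symmetric] real_sqrt_mult[symmetric] modular_pos less_imp_le mult.commute)
  qed (use modular_pos[of "\<phi> o'" o'] in simp_all)
qed

text \<open>The expected weight at time \<open>n\<close> of a one-sided walk decays like
  \<open>\<rho> ^ n\<close>, so the expected sum is a geometric series and the sum itself is almost
  surely finite.\<close>

lemma total_weight_finite:
  fixes g :: "'v \<Rightarrow> ennreal"
  assumes g: "\<And>x. g x \<noteq> \<infinity>" and \<rho>: "0 \<le> \<rho>" "\<rho> < 1"
    and avg: "\<And>x. (\<Sum>y\<in>nbrs E x. g y) / of_nat deg = ennreal \<rho> * g x"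
  shows "AE w in walk_measure. (\<integral>\<^sup>+ n. g (w n) \<partial>count_space UNIV) \<noteq> \<infinity>"
proof (rule AE_walk_measureI)
  have [measurable]: "(\<lambda>w. g (w n)) \<in> borel_measurable path_space" for n :: int
    by (rule measurable_compose[OF path_evaluation_measurable]) simp
  have meas_nat [measurable]: "(\<lambda>w. g (w n)) \<in> borel_measurable path_space" for n :: nat
    by (rule measurable_compose[OF path_evaluation_measurable]) simp
  show P: "Measurable.pred path_space (\<lambda>w :: int \<Rightarrow> 'v. (\<integral>\<^sup>+ n. g (w n) \<partial>count_space UNIV) \<noteq> \<infinity>)"
    unfolding nn_integral_count_space_int by measurable
  fix x
  show "AE w in two_sided x. (\<integral>\<^sup>+ n. g (w n) \<partial>count_space UNIV) \<noteq> \<infinity>"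
  proof (rule AE_two_sidedI[OF P])
    let ?good = "\<lambda>\<omega>. (\<Sum>n. g (\<omega> n)) \<noteq> \<infinity>"
    have "(\<integral>\<^sup>+ \<omega>. (\<Sum>n. g (\<omega> n)) \<partial>srw E x) = (\<Sum>n. ennreal \<rho> ^ n * g x)"
      by (subst nn_integral_suminf) (simp_all add: nn_integral_srw_power[OF avg])
    also have "\<dots> = (\<Sum>n. ennreal (\<rho> ^ n)) * g x"
      using \<rho> by (simp add: ennreal_suminf_multc ennreal_power)
    also have "(\<Sum>n. ennreal (\<rho> ^ n)) = ennreal (\<Sum>n. \<rho> ^ n)"
      using \<rho> by (intro suminf_ennreal2) (auto intro: summable_geometric)
    finally have "(\<integral>\<^sup>+ \<omega>. (\<Sum>n. g (\<omega> n)) \<partial>srw E x) \<noteq> \<infinity>"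
      using g by (simp add: ennreal_mult_eq_top_iff)
    then show "AE \<omega> in srw E x. ?good \<omega>"
      by (intro nn_integral_PInf_AE) (simp_all add: measurable_cong_sets[OF sets_srw refl])
    show "(\<integral>\<^sup>+ n. g (glue_paths (\<omega>, \<omega>') n) \<partial>count_space UNIV) \<noteq> \<infinity>" if "?good \<omega>" "?good \<omega>'" for \<omega> \<omega>'
    proof -
      \<comment> \<open>The glued path takes its value at time 0 from \<open>\<omega>\<close>, which
        costs the extra term \<open>g (\<omega> 0)\<close> in the backward half.\<close>
      have "(\<Sum>n. g (glue_paths (\<omega>, \<omega>') (- int n))) \<le> (\<Sum>n. g (\<omega> 0) * indicator {0} n + g (\<omega>' n))"
        by (intro suminf_le) (auto simp: glue_paths_def)
      also have "\<dots> = g (\<omega> 0) + (\<Sum>n. g (\<omega>' n))"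
      proof -
        have "suminf (indicator {0} :: nat \<Rightarrow> ennreal) = 1"
          by (subst suminf_finite[of "{0}"]) auto
        then show ?thesis by (simp add: suminf_add[symmetric])
      qed
      finally have "(\<Sum>n. g (glue_paths (\<omega>, \<omega>') (- int n))) \<le> g (\<omega> 0) + (\<Sum>n. g (\<omega>' n))" .
      moreover have "(\<Sum>n. g (glue_paths (\<omega>, \<omega>') (int n))) = (\<Sum>n. g (\<omega> n))"
        by (simp add: glue_paths_def)
      ultimately have "(\<integral>\<^sup>+ n. g (glue_paths (\<omega>, \<omega>') n) \<partial>count_space UNIV) \<le> (\<Sum>n. g (\<omega> n)) + (g (\<omega> 0) + (\<Sum>n. g (\<omega>' n)))"
        using nn_integral_count_space_int_le[of "\<lambda>n. g (glue_paths (\<omega>, \<omega>') n)"] by (simp add: add_left_mono order_trans)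
      then show ?thesis using that g by (auto simp: top_unique)
    qed
  qed
qed

lemma invariant_lift_if_not_unimodular:
  assumes \<nu>: "is_interlacement_intensity E \<nu>" and nonunimod: "\<not> unimodular_graph E"
  shows "\<exists>Q :: (int \<Rightarrow> 'v) measure. space Q = trajs E \<and> sets Q = sets (traj_space E) \<and>
    (\<forall>A\<in>sets_star E. emeasure \<nu> A = emeasure Q (preimage_star E A)) \<and>
    (\<forall>B\<in>sets (traj_space E). \<forall>\<phi>\<in>\<Gamma>. emeasure Q B = emeasure Q ((\<lambda>w. \<phi> \<circ> w) ` B))"
proof -
  obtain g :: "'v \<Rightarrow> ennreal" and \<rho> :: real where g: "\<And>x. g x \<noteq> 0" "\<And>x. g x \<noteq> \<infinity>"
    and \<rho>: "0 \<le> \<rho>" "\<rho> < 1" and avg: "\<And>x. (\<Sum>y\<in>nbrs E x. g y) / of_nat deg = ennreal \<rho> * g x"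
    and g_aut: "\<And>\<phi>. \<phi> \<in> \<Gamma> \<Longrightarrow> \<exists>c. c \<noteq> 0 \<and> c \<noteq> \<infinity> \<and> (\<forall>x. g (\<phi> x) = c * g x)"
    using ex_contracting_weight[OF nonunimod] by metis
  define total where "total w = (\<integral>\<^sup>+ n. g (w n) \<partial>count_space UNIV)" for w :: "int \<Rightarrow> 'v"
  define h where "h w = g (w 0) / total w" for w
  note cong = measurable_cong_sets[OF sets_walk_measure refl]
  have meas [measurable]: "(\<lambda>w. g (w n)) \<in> borel_measurable path_space" for n :: int
    by (rule measurable_compose[OF path_evaluation_measurable]) simp
  have h_meas: "h \<in> borel_measurable path_space"
    unfolding h_def[abs_def] total_def[abs_def] nn_integral_count_space_int by measurable
  have total_finite: "AE w in walk_measure. total w \<noteq> \<infinity>"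
    unfolding total_def by (rule total_weight_finite[OF g(2) \<rho> avg])
  \<comment> \<open>With finiteness this makes \<open>total w / total w\<close> equal to 1; division
    in \<open>ennreal\<close> would otherwise not normalize.\<close>
  have total_nonzero: "total w \<noteq> 0" for w
  proof -
    have "g (w 0) \<le> total w" unfolding total_def by (rule nn_integral_ge_point) simp
    then show ?thesis using g(1)[of "w 0"] by auto
  qed
  have total_shift: "total (time_shift k w) = total w" for k w
    unfolding total_def
    by (rule nn_integral_bij_count_space[where g="\<lambda>n. n + k" and f="\<lambda>n. g (w n)"])
       (auto intro!: bij_betw_byWitness[where f'="\<lambda>n. n - k"])
  have h_aut: "h (\<phi> \<circ> w) = h w" if \<phi>: "\<phi> \<in> \<Gamma>" for \<phi> w
  proof -
    obtain c where c: "c \<noteq> 0" "c \<noteq> \<infinity>" "\<And>x. g (\<phi> x) = c * g x" using g_aut[OF \<phi>] by blast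
    have "total (\<phi> \<circ> w) = c * total w" unfolding total_def by (simp add: c nn_integral_cmult)
    then show ?thesis using c unfolding h_def by (simp add: ennreal_divide_cancel_left)
  qed
  have h_sum: "(\<integral>\<^sup>+ n. h (time_shift n w) \<partial>count_space UNIV) = 1" if "total w \<noteq> \<infinity>" for w
  proof -
    have "(\<integral>\<^sup>+ n. h (time_shift n w) \<partial>count_space UNIV) = total w / total w"
      unfolding h_def total_shift by (simp add: nn_integral_divide total_def)
    also have "\<dots> = 1" using that total_nonzero[of w] by (intro ennreal_divide_self) (auto simp: top.not_eq_extremum)
    finally show ?thesis .
  qed
  define Q where "Q = restrict_space (density walk_measure h) (trajs E)"
  have Q_em: "emeasure Q B = (\<integral>\<^sup>+ w. h w * indicator B w \<partial>walk_measure)"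
    if "B \<in> sets path_space" "B \<subseteq> trajs E" for B
    unfolding Q_def using that trajs_in_sets
    by (subst emeasure_restrict_space) (auto simp: sets_walk_measure emeasure_density cong h_meas)
  have space_Q: "space Q = trajs E" by (simp add: Q_def space_restrict_space)
  have sets_Q: "sets Q = sets (traj_space E)"
    unfolding Q_def sets_traj_space_eq_restrict_space
    by (rule sets_restrict_space_cong) (simp add: sets_walk_measure)
  have Q_inv: "emeasure Q B = emeasure Q ((\<lambda>w. \<phi> \<circ> w) ` B)" if B: "B \<in> sets (traj_space E)" and \<phi>: "\<phi> \<in> \<Gamma>" for B \<phi>
  proof -
    let ?B = "(\<lambda>w. \<phi> \<circ> w) ` B"
    from B have B': "B \<in> sets path_space" "B \<subseteq> trajs E" by (auto simp: sets_traj_space_iff)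
    \<comment> \<open>Writing the image as a preimage under the inverse automorphism makes it
      measurable.\<close>
    have "?B = (\<lambda>w. inv \<phi> \<circ> w) -` B"
    proof (intro set_eqI iffI)
      fix w assume "w \<in> (\<lambda>w. inv \<phi> \<circ> w) -` B"
      moreover have "w = \<phi> \<circ> (inv \<phi> \<circ> w)" by (auto simp: fun_eq_iff aut_inv_apply[OF \<phi>])
      ultimately show "w \<in> ?B" by blast
    qed (auto simp: comp_assoc[symmetric] aut_bij[OF \<phi>] bij_is_inj)
    then have sets: "?B \<in> sets path_space"
      using measurable_sets[OF measurable_vertex_map B'(1), of "inv \<phi>"] by (simp add: space_PiM)
    have sub: "?B \<subseteq> trajs E" using B' comp_in_trajs[OF \<phi>] by auto
    have mem: "\<phi> \<circ> w \<in> ?B \<longleftrightarrow> w \<in> B" for w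
      by (auto simp: image_iff fun_eq_iff aut_eq_iff[OF \<phi>]) (metis ext)
    have "emeasure Q ?B = (\<integral>\<^sup>+ w. h w * indicator ?B w \<partial>distr walk_measure path_space (\<lambda>w. \<phi> \<circ> w))"
      by (simp only: Q_em[OF sets sub] walk_measure_aut[OF \<phi>])
    also have "\<dots> = (\<integral>\<^sup>+ w. h (\<phi> \<circ> w) * indicator ?B (\<phi> \<circ> w) \<partial>walk_measure)"
      by (rule nn_integral_distr)
         (simp_all only: cong measurable_vertex_map measurable_distr_eq1 borel_measurable_times_ennreal h_meas
            borel_measurable_indicator sets)
    also have "\<dots> = (\<integral>\<^sup>+ w. h w * indicator B w \<partial>walk_measure)"
      by (simp only: h_aut[OF \<phi>] indicator_def mem)
    finally show ?thesis by (simp only: Q_em[OF B'])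
  qed
  have sets_\<nu>: "sets \<nu> = sets_star E" using \<nu> by (simp add: is_interlacement_intensity_def)
  have lift_hitting: "emeasure \<nu> (A \<inter> trajs_star_hitting E K) = emeasure Q (preimage_star E (A \<inter> trajs_star_hitting E K))"
    if A: "A \<in> sets_star E" and K: "finite K" for A K
  proof -
    let ?B = "preimage_star E A"
    have B: "?B \<in> sets path_space" "?B \<subseteq> trajs E"
      using A by (auto simp: preimage_star_in_sets preimage_star_subset)
    have eq: "preimage_star E (A \<inter> trajs_star_hitting E K) = {w \<in> ?B. \<exists>n. w n \<in> K}"
      using B by (auto simp: preimage_star_Int preimage_star_hitting)
    have sets: "{w \<in> ?B. \<exists>n. w n \<in> K} \<in> sets path_space"
    proof -
      have "{w \<in> ?B. \<exists>n. w n \<in> K} = ?B \<inter> {w \<in> trajs E. \<exists>n. w n \<in> K}" using B by auto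
      then show ?thesis using B(1) hitting_in_sets[of K] by (simp only: sets.Int)
    qed
    have "emeasure Q {w \<in> ?B. \<exists>n. w n \<in> K} = (\<integral>\<^sup>+ w. h w * indicator {w \<in> ?B. \<exists>n. w n \<in> K} w \<partial>walk_measure)"
      by (rule Q_em[OF sets]) (use B in auto)
    also have "\<dots> = (\<integral>\<^sup>+ w. (\<integral>\<^sup>+ n. h (time_shift n w) \<partial>count_space UNIV) * indicator {w \<in> ?B. enters K 0 w} w \<partial>walk_measure)"
      by (rule nn_integral_walk_measure_hitting[OF K B time_shift_in_preimage_star h_meas])
    \<comment> \<open>For almost every path the density sums to 1 over its shifts, so the orbit sum
      disappears.\<close>
    also have "\<dots> = (\<integral>\<^sup>+ w. indicator {w \<in> ?B. enters K 0 w} w \<partial>walk_measure)"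
      using total_finite by (intro nn_integral_cong_AE) (auto elim!: eventually_mono simp: h_sum)
    also have "\<dots> = emeasure walk_measure {w \<in> ?B. enters K 0 w}"
      by (rule nn_integral_indicator) (simp only: sets_walk_measure enters_in_sets[OF B(1)])
    also have "\<dots> = emeasure \<nu> (A \<inter> trajs_star_hitting E K)"
      by (rule emeasure_intensity_hitting[OF \<nu> A K, symmetric])
    finally show ?thesis by (simp only: eq)
  qed
  have lift: "emeasure \<nu> A = emeasure Q (preimage_star E A)" if A: "A \<in> sets_star E" for A
  proof -
    \<comment> \<open>The intensity is specified only on trajectories hitting a finite set. Finite
      sets from an enumeration of the vertices exhaust the graph, and each class is caught once the
      enumeration reaches a vertex of a representative.\<close>
    define K where "K i = from_nat_into (UNIV :: 'v set) ` {..i}" for i :: nat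
    define A' where "A' i = A \<inter> trajs_star_hitting E (K i)" for i
    have K: "finite (K i)" for i by (simp add: K_def)
    have K_mono: "K i \<subseteq> K j" if "i \<le> j" for i j using that by (auto simp: K_def)
    have A'_star: "A' i \<in> sets_star E" for i
      unfolding A'_def sets_\<nu>[symmetric] using A trajs_star_hitting_in_sets_star[of "K i"]
      by (intro sets.Int) (simp_all only: sets_\<nu>)
    have inc: "incseq A'"
      using K_mono by (fastforce simp: incseq_def A'_def trajs_star_hitting_def)
    have un: "(\<Union>i. A' i) = A"
    proof
      show "A \<subseteq> (\<Union>i. A' i)"
      proof
        fix a assume a: "a \<in> A"
        then have "a \<in> trajs_star E" using A by (auto simp: sets_star_def)
        then obtain w where w: "w \<in> trajs E" "a = proj_star E w"
          by (auto simp: trajs_star_def proj_star_def elim!: quotientE)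
        obtain i where "from_nat_into UNIV i = w 0"
          using from_nat_into_surj[OF countable_vertices UNIV_I] by blast
        then have "w 0 \<in> K i" unfolding K_def by (metis atMost_iff image_eqI order_refl)
        then have "a \<in> A' i" using a w by (auto simp: A'_def trajs_star_hitting_def)
        then show "a \<in> (\<Union>i. A' i)" by blast
      qed
    qed (auto simp: A'_def)
    have "emeasure \<nu> A = (SUP i. emeasure \<nu> (A' i))"
      using SUP_emeasure_incseq[OF _ inc, of \<nu>] A'_star un by (simp add: sets_\<nu> image_subset_iff)
    also have "\<dots> = (SUP i. emeasure Q (preimage_star E (A' i)))"
      unfolding A'_def by (simp only: lift_hitting[OF A K])
    also have "\<dots> = emeasure Q (\<Union>i. preimage_star E (A' i))"
    proof (rule SUP_emeasure_incseq)
      show "range (\<lambda>i. preimage_star E (A' i)) \<subseteq> sets Q"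
        using A'_star by (auto simp: sets_Q sets_star_def)
      show "incseq (\<lambda>i. preimage_star E (A' i))"
        using inc by (fastforce simp: incseq_def preimage_star_def)
    qed
    also have "(\<Union>i. preimage_star E (A' i)) = preimage_star E A"
      unfolding un[symmetric] by (auto simp: preimage_star_def)
    finally show ?thesis .
  qed
  show ?thesis using space_Q sets_Q lift Q_inv by blast
qed

end

theorem proposition1p3:
  fixes E :: "'v set set" and \<nu> :: "(int \<Rightarrow> 'v) set measure"
  assumes "simple_graph E"
    and "locally_finite_graph E"
    and "connected_graph E"
    and "transitive_graph E"
    and "transient_graph E"
    and "is_interlacement_intensity E \<nu>"
  shows "unimodular_graph E \<longleftrightarrow>
    \<not> (\<exists>Q :: (int \<Rightarrow> 'v) measure.
          space Q = trajs E \<and> sets Q = sets (traj_space E) \<and>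
          (\<forall>A\<in>sets_star E. emeasure \<nu> A = emeasure Q (preimage_star E A)) \<and>
          (\<forall>B\<in>sets (traj_space E). \<forall>\<phi>\<in>graph_aut E.
              emeasure Q B = emeasure Q ((\<lambda>w. \<phi> \<circ> w) ` B)))"
proof -
  interpret transitive_network E
    by unfold_locales (fact assms)+
  show ?thesis
  proof
    assume "unimodular_graph E"
    then show "\<not> (\<exists>Q :: (int \<Rightarrow> 'v) measure.
          space Q = trajs E \<and> sets Q = sets (traj_space E) \<and>
          (\<forall>A\<in>sets_star E. emeasure \<nu> A = emeasure Q (preimage_star E A)) \<and>
          (\<forall>B\<in>sets (traj_space E). \<forall>\<phi>\<in>graph_aut E.
              emeasure Q B = emeasure Q ((\<lambda>w. \<phi> \<circ> w) ` B)))"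
      using no_invariant_lift_if_unimodular[OF assms(6)] by blast
  qed (use invariant_lift_if_not_unimodular[OF assms(6)] in blast)
qed

end
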